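(* Let $m\ge2$, let $C_1,\dots,C_m$ be closed subsets of a Euclidean space $X$, $I=\{1,\dots,m\}$, $w\in C:=\bigcap_{i\in I}C_i$, $\varepsilon\in(0,1)$ and $\delta>0$. For every $i\in I$, let $\tau_i\ge0$ and $\alpha_i\in[0,1]$, where there is at most one $\alpha_j$ equal to $1$. Set $J:=\{j\in I:\alpha_j=1\}$ and $$\Gamma:=\Big(\frac{\gamma_1\cdots\gamma_m}{\min_{i\in I}\gamma_i^{1-|J|}}\Big)^{1/2},\qquad\text{where }\gamma_i:=\frac{1+\alpha_i\varepsilon}{1-\varepsilon}\ \text{ for every } i\in I.$$ Suppose that: (a) $\{C_i\}_{i\in I}$ is $\kappa$-linearly regular on $\mathbb{B}(w;\delta/2)$ for some $\kappa>0$. (b) $\{C_i\}_{i\in I}$ is $(\varepsilon,\delta)$-regular at $w$. (c) For every $i\in I$, $C_i$ is $\tau_i$-injectable on $\mathbb{B}(w;\delta/2)$. (d) It holds that $$\rho:=\left[\Gamma^2-\frac{1}{\kappa^2}\Big(\sum_{i\in I\setminus J}\frac{1+\alpha_i}{1-\alpha_i}-(1-|J|)\min_{i\in I\setminus J}\frac{1+\alpha_i}{1-\alpha_i}\Big)^{-1}\Big(\frac{1+\varepsilon}{1-\varepsilon}\Big)^{|J|}\right]_+^{\frac{1}{2(m-1+|J|)}}<1.$$ Then, whenever the starting point $x_0$ is sufficiently close to $w$ (i.e., there is $r>0$ such that this holds for all $x_0\in\mathbb{B}(w;r)$), every cyclic sequence $(x_n)_{n\in\mathbb{N}}$ generated by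 the semi-intrepid projections $\big(P_{C_i}^{(\alpha_i,\tau_i)}\big)_{i\in I}$ converges $R$-linearly to a point in $C$ with rate $\rho$. In particular, this linear convergence of $(x_n)_{n\in\mathbb{N}}$ is guaranteed provided that either $(x_{(m-1+|J|)n})_{n\in\mathbb{N}}\subset\mathbb{B}(w;\delta')$ or $x_0\in\mathbb{B}\big(w;\frac{\delta'(1-\rho)}{2+\Gamma-\rho}\big)$, where $\delta':=\frac{\delta}{2\Gamma}\min_{i\in I}\gamma_i^{1/2}\big(\max_{i\in I}\gamma_i^{1/2}\big)^{|J|-1}$.
   Context: $X$ is a Euclidean space with inner product $\langle\cdot,\cdot\rangle$ and norm $\|\cdot\|$. $\mathbb{B}(w;\rho)$ is the closed ball with center $w$ and radius $\rho$. $[t]_+:=\max\{0,t\}$; $|J|$ is the number of elements of $J$. For a nonempty closed set $C$: $d_C(x)=\inf_{c\in C}\|x-c\|$ and $P_Cx=\{c\in C:\|x-c\|=d_C(x)\}$ (set-valued projector). Injectability: a nonempty closed set $C$ is $\tau$-injectable on $U\subseteq X$ ($\tau\ge0$) if for all $x\in U$ and $p\in P_Cx$, the segment $\big[p,\,p+\tau\frac{p-x}{\|p-x\|}\big]$ is contained in $C$, with the convention $\frac{p-x}{\|p-x\|}=0$ if $p=x$. Semi-intrepid projector: for $\alpha\in[0,1]$, $\tau\ge0$ and a set $C$ that is $\tau$-injectable on a given set $U$, $P_C^{(\alpha,\tau)}x:=\big\{p+(p-x)\min\{\alpha,\tfrac{\tau}{\|p-x\|}\}: p\in P_Cx\big\}$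 for $x\in X$, with the convention $\frac{\tau}{\|p-x\|}=0$ if $p=x$. Cyclic sequences: for set-valued operators $T_1,\dots,T_m$ on $X$, put $T_{mn+i}:=T_i$ for $n\in\mathbb{N}$, $i\in I$; a cyclic sequence generated by $(T_i)_{i\in I}$ is any sequence with $x_0\in X$ and $x_{n+1}\in T_{n+1}x_n$ for all $n\in\mathbb{N}=\{0,1,2,\dots\}$. $R$-linear convergence: $(x_n)$ converges $R$-linearly to $\bar x$ with rate $\rho\in[0,1)$ if there is $\sigma\ge0$ with $\|x_n-\bar x\|\le\sigma\rho^n$ for all $n\in\mathbb{N}$. Linear regularity: $\{C_i\}_{i\in I}$ is $\kappa$-linearly regular on $U\subseteq X$ if $d_C(x)\le\kappa\max_{i\in I}d_{C_i}(x)$ for all $x\in U$, where $C=\bigcap_{i\in I}C_i$. Regularity of sets: the proximal normal cone to $C$ at $x\in C$ is $N^{\rm prox}_C(x)=\{\lambda(z-x): x\in P_Cz,\ \lambda\ge0\}$. $C$ is $(\varepsilon,\delta)$-regular at $w$ if for all $x,y\in C\cap\mathbb{B}(w;\delta)$ and $u\in N^{\rm prox}_C(x)$ one has $\langle u,x-y\rangle\ge-\varepsilon\|u\|\,\|x-y\|$. The system $\{C_i\}_{i\in I}$ is $(\varepsilon,\delta)$-regular at $w$ if every $C_i$ is. *)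

theory Defs
  imports "HOL-Analysis.Analysis"
begin

text \<open>
  The distance function of a nonempty set \<open>C\<close> is \<^const>\<open>infdist\<close> \<open>x C\<close>. The sets below are
  meant to be nonempty and closed; this is a hypothesis wherever the definitions are used.
  The conventions for \<open>p = x\<close> in \<open>(p - x) / norm (p - x)\<close> and \<open>\<tau> / norm (p - x)\<close>
  (both are read as \<open>0\<close>) agree with division by zero in HOL.
\<close>

definition projector :: "'a::euclidean_space set \<Rightarrow> 'a \<Rightarrow> 'a set" where
  "projector C x = {c \<in> C. norm (x - c) = infdist x C}"

definition injectable_on :: "real \<Rightarrow> 'a::euclidean_space set \<Rightarrow> 'a set \<Rightarrow> bool" where
  "injectable_on \<tau> C U \<longleftrightarrow>
     (\<forall>x\<in>U. \<forall>p\<in>projector C x.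
        closed_segment p (p + \<tau> *\<^sub>R ((p - x) /\<^sub>R norm (p - x))) \<subseteq> C)"

definition semi_intrepid_projector ::
    "real \<Rightarrow> real \<Rightarrow> 'a::euclidean_space set \<Rightarrow> 'a \<Rightarrow> 'a set" where
  "semi_intrepid_projector \<alpha> \<tau> C x =
     {p + min \<alpha> (\<tau> / norm (p - x)) *\<^sub>R (p - x) | p. p \<in> projector C x}"

text \<open>
  The operators are \<open>T 1, \<dots>, T m\<close>, extended periodically by \<open>T (m * n + i) = T i\<close> for
  \<open>i \<in> {1..m}\<close>; hence the operator with index \<open>n + 1\<close> is \<open>T (n mod m + 1)\<close>.
\<close>

definition cyclic_sequence ::
    "nat \<Rightarrow> (nat \<Rightarrow> 'a \<Rightarrow> 'a set) \<Rightarrow> (nat \<Rightarrow> 'a) \<Rightarrow> bool" where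
  "cyclic_sequence m T x \<longleftrightarrow> (\<forall>n. x (n + 1) \<in> T (n mod m + 1) (x n))"

definition converges_R_linearly ::
    "(nat \<Rightarrow> 'a::euclidean_space) \<Rightarrow> 'a \<Rightarrow> real \<Rightarrow> bool" where
  "converges_R_linearly x xbar \<rho> \<longleftrightarrow>
     0 \<le> \<rho> \<and> \<rho> < 1 \<and> (\<exists>\<sigma>\<ge>0. \<forall>n. norm (x n - xbar) \<le> \<sigma> * \<rho> ^ n)"

definition linearly_regular_on ::
    "real \<Rightarrow> 'i set \<Rightarrow> ('i \<Rightarrow> 'a::euclidean_space set) \<Rightarrow> 'a set \<Rightarrow> bool" where
  "linearly_regular_on \<kappa> I C U \<longleftrightarrow>
     (\<forall>x\<in>U. infdist x (\<Inter>i\<in>I. C i) \<le> \<kappa> * (MAX i\<in>I. infdist x (C i)))"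

definition prox_normal_cone :: "'a::euclidean_space set \<Rightarrow> 'a \<Rightarrow> 'a set" where
  "prox_normal_cone C x = {t *\<^sub>R (z - x) | t z. x \<in> projector C z \<and> t \<ge> 0}"

definition regular_at :: "real \<Rightarrow> real \<Rightarrow> 'a::euclidean_space set \<Rightarrow> 'a \<Rightarrow> bool" where
  "regular_at \<epsilon> \<delta> C w \<longleftrightarrow>
     (\<forall>x \<in> C \<inter> cball w \<delta>. \<forall>y \<in> C \<inter> cball w \<delta>. \<forall>u \<in> prox_normal_cone C x.
        inner u (x - y) \<ge> - \<epsilon> * norm u * norm (x - y))"

definition system_regular_at ::
    "real \<Rightarrow> real \<Rightarrow> 'i set \<Rightarrow> ('i \<Rightarrow> 'a::euclidean_space set) \<Rightarrow> 'a \<Rightarrow> bool" where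
  "system_regular_at \<epsilon> \<delta> I C w \<longleftrightarrow> (\<forall>i\<in>I. regular_at \<epsilon> \<delta> (C i) w)"

end

theory Submission
  imports Defs
begin

text \<open>
  Injectability keeps every iterate in the set it was projected on, and regularity makes one step
  quasi firmly Fejer monotone: \<open>|x' - y|\<^sup>2 + \<beta> |x - x'|\<^sup>2 \<le> \<gamma> |x - y|\<^sup>2\<close> with
  \<open>\<beta> = (1 - \<alpha>) / (1 + \<alpha>)\<close>. Start a block of \<open>m - 1\<close> steps at an iterate that already lies in one
  of the sets, namely in \<open>C j\<close> if \<open>J = {j}\<close>. The block visits all other sets, so by Cauchy-Schwarz
  the squared step lengths weighted by \<open>\<beta>\<close> bound the distance to every \<open>C i\<close> at its start;
  with linear regularity and \<open>y\<close> a projection on the intersection, this gives contraction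
  by \<open>\<rho> ^ M\<close> over \<open>M = m - 1 + |J|\<close> steps, the reflecting step \<open>j\<close> costing only its factor \<open>\<gamma> j\<close>.

  The value \<open>\<rho> = 0\<close>, for which linear convergence with rate \<open>\<rho>\<close> means \<open>x 1 = x 2 = \<dots>\<close> is the
  limit, occurs only if \<open>\<kappa> < 1\<close>; then the ball lies in the intersection and the sequence is
  constant.

  In general \<open>x 0\<close> is not the start of such a block. That iterates starting near \<open>w\<close> stay in the
  ball is seen by tracking the projections of the block starts on the intersection.
\<close>

section \<open>Single projections: membership, step length and the quasi firm Fejer estimate\<close>

lemma projector_nonempty:
  assumes "closed C" "C \<noteq> {}"
  shows "projector C x \<noteq> {}"
proof -
  obtain p where "p \<in> C" "infdist x C = dist x p"
    using infdist_attains_inf[OF assms] by metis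
  then show ?thesis by (auto simp: projector_def dist_norm)
qed

lemma projectorD:
  assumes "p \<in> projector C x"
  shows "p \<in> C" "norm (x - p) = infdist x C"
  using assms by (auto simp: projector_def)

lemma projector_norm_le:
  assumes "p \<in> projector C x" "c \<in> C"
  shows "norm (x - p) \<le> norm (x - c)"
  using assms infdist_le[of c C x] by (simp add: projector_def dist_norm)

lemma projector_norm_diff_le:
  assumes "p \<in> projector C x" "c \<in> C"
  shows "norm (p - c) \<le> 2 * norm (x - c)"
  using projector_norm_le[OF assms] norm_triangle_ineq[of "p - x" "x - c"] norm_minus_commute[of p x]
  by simp

text \<open>The factor \<open>min \<alpha> (\<tau> / norm (p - x))\<close> caps the overshoot beyond
  \<open>p\<close> at length \<open>\<tau>\<close>, so the displaced point lies on the injectability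
  segment, with parameter \<open>t\<close> equal to overshoot divided by
  \<open>\<tau>\<close>.\<close>

lemma semi_intrepid_projector_mem:
  assumes inj: "injectable_on \<tau> C U" and x: "x \<in> U"
    and z: "z \<in> semi_intrepid_projector \<alpha> \<tau> C x"
    and "0 \<le> \<alpha>" "0 \<le> \<tau>"
  shows "z \<in> C"
proof -
  obtain p where p: "p \<in> projector C x" and z: "z = p + min \<alpha> (\<tau> / norm (p - x)) *\<^sub>R (p - x)"
    using z by (auto simp: semi_intrepid_projector_def)
  define lam where "lam = min \<alpha> (\<tau> / norm (p - x))"
  show ?thesis
  proof (cases "p = x \<or> \<tau> = 0")
    case True
    with p z \<open>0 \<le> \<alpha>\<close> show ?thesis by (auto simp: projector_def)
  next
    case False
    then have n: "norm (p - x) > 0" and "\<tau> > 0" using \<open>0 \<le> \<tau>\<close> by auto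
    define t where "t = lam * norm (p - x) / \<tau>"
    have "lam * norm (p - x) \<le> \<tau>"
      using n by (simp add: lam_def min_def field_simps)
    moreover have "lam \<ge> 0" using assms by (simp add: lam_def)
    ultimately have t: "0 \<le> t" "t \<le> 1"
      using \<open>\<tau> > 0\<close> n by (auto simp: t_def)
    define v where "v = \<tau> *\<^sub>R ((p - x) /\<^sub>R norm (p - x))"
    have "t *\<^sub>R v = lam *\<^sub>R (p - x)"
      using False n by (simp add: t_def v_def field_simps)
    then have "z = (1 - t) *\<^sub>R p + t *\<^sub>R (p + v)"
      by (simp add: z lam_def[symmetric] algebra_simps)
    then have "z \<in> closed_segment p (p + v)"
      using t by (auto simp: in_segment)
    then show ?thesis using inj x p by (auto simp: injectable_on_def v_def)
  qed
qed

lemma semi_intrepid_projector_fixed: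
  assumes "x \<in> C" "z \<in> semi_intrepid_projector \<alpha> \<tau> C x"
  shows "z = x"
  using assms by (auto simp: semi_intrepid_projector_def projector_def)

lemma semi_intrepid_projector_dist:
  assumes z: "z \<in> semi_intrepid_projector \<alpha> \<tau> C x"
    and "0 \<le> \<alpha>" "\<alpha> \<le> 1" "0 \<le> \<tau>"
  shows "norm (z - x) \<le> 2 * infdist x C"
proof -
  obtain p where p: "p \<in> projector C x" and z: "z = p + min \<alpha> (\<tau> / norm (p - x)) *\<^sub>R (p - x)"
    using z by (auto simp: semi_intrepid_projector_def)
  have "z - x = (1 + min \<alpha> (\<tau> / norm (p - x))) *\<^sub>R (p - x)"
    by (simp add: z algebra_simps)
  then have "norm (z - x) = (1 + min \<alpha> (\<tau> / norm (p - x))) * norm (p - x)"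
    using assms by simp
  also have "\<dots> \<le> 2 * norm (p - x)"
    using assms by (intro mult_right_mono) auto
  finally show ?thesis using projectorD(2)[OF p] by (simp add: norm_minus_commute)
qed

text \<open>All norms are expanded around \<open>p\<close> in terms of \<open>a\<close>,
  \<open>b\<close> and \<open>s\<close>; regularity enters only as the lower bound on
  \<open>s\<close>. The weight is chosen so that the two contributions of \<open>a\<^sup>2\<close>
  on the left add up to at most 1.\<close>

lemma semi_intrepid_projector_quasi_firm:
  assumes reg: "regular_at \<epsilon> \<delta> C w" and w: "w \<in> C" and x: "x \<in> cball w (\<delta> / 2)"
    and z: "z \<in> semi_intrepid_projector \<alpha> \<tau> C x"
    and \<alpha>: "0 \<le> \<alpha>" "\<alpha> \<le> 1" and \<tau>: "0 \<le> \<tau>" and \<epsilon>: "0 < \<epsilon>" "\<epsilon> < 1"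
    and y: "y \<in> C" "y \<in> cball w \<delta>"
  shows "(norm (z - y))\<^sup>2 + (1 - \<alpha>) / (1 + \<alpha>) * (norm (x - z))\<^sup>2
    \<le> (1 + \<alpha> * \<epsilon>) / (1 - \<epsilon>) * (norm (x - y))\<^sup>2"
proof -
  obtain p where p: "p \<in> projector C x" and z: "z = p + min \<alpha> (\<tau> / norm (p - x)) *\<^sub>R (p - x)"
    using z by (auto simp: semi_intrepid_projector_def)
  define lam where "lam = min \<alpha> (\<tau> / norm (p - x))"
  have lam: "0 \<le> lam" "lam \<le> \<alpha>" using \<alpha> \<tau> by (auto simp: lam_def)
  define a b s where "a = norm (x - p)" and "b = norm (p - y)" and "s = (x - p) \<bullet> (p - y)"
  have "p \<in> C" using p by (rule projectorD)
  \<comment> \<open>Projecting can double the distance to \<open>w\<close>, hence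
    \<open>\<delta> / 2\<close> for \<open>x\<close> against \<open>\<delta>\<close> in the
    regularity hypothesis.\<close>
  have "norm (p - w) \<le> \<delta>"
    using projector_norm_diff_le[OF p w] x by (simp add: dist_norm norm_minus_commute)
  then have "p \<in> C \<inter> cball w \<delta>" using \<open>p \<in> C\<close> by (simp add: dist_norm norm_minus_commute)
  moreover have "x - p \<in> prox_normal_cone C p"
    unfolding prox_normal_cone_def using p by (auto intro!: exI[of _ 1])
  ultimately have s: "s \<ge> - \<epsilon> * a * b"
    using reg y by (auto simp: regular_at_def a_def b_def s_def)
  have xy: "(norm (x - y))\<^sup>2 = a\<^sup>2 + 2 * s + b\<^sup>2"
    unfolding a_def b_def s_def power2_norm_eq_inner
    by (simp add: inner_diff inner_commute algebra_simps)
  have zy_eq: "z - y = (p - y) - lam *\<^sub>R (x - p)" by (simp add: z lam_def algebra_simps)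
  have zy: "(norm (z - y))\<^sup>2 = b\<^sup>2 - 2 * lam * s + lam\<^sup>2 * a\<^sup>2"
    unfolding zy_eq a_def b_def s_def power2_norm_eq_inner
    by (simp add: inner_diff inner_commute algebra_simps power2_eq_square)
  have "x - z = (1 + lam) *\<^sub>R (x - p)" by (simp add: z lam_def algebra_simps)
  then have xz: "(norm (x - z))\<^sup>2 = (1 + lam)\<^sup>2 * a\<^sup>2"
    unfolding a_def using lam by (simp add: power_mult_distrib)
  \<comment> \<open>The weight decreases in its argument, so the actual overshoot factor
    \<open>lam\<close> may replace \<open>\<alpha>\<close>.\<close>
  have "(1 - \<alpha>) / (1 + \<alpha>) \<le> (1 - lam) / (1 + lam)"
    using lam \<alpha> by (simp add: field_simps)
  then have "(1 - \<alpha>) / (1 + \<alpha>) * (norm (x - z))\<^sup>2 \<le> (1 - lam) / (1 + lam) * ((1 + lam)\<^sup>2 * a\<^sup>2)"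
    unfolding xz by (intro mult_right_mono) auto
  also have "\<dots> = (1 - lam\<^sup>2) * a\<^sup>2"
    using lam by (simp add: power2_eq_square divide_simps) (simp add: algebra_simps)
  finally have "(norm (z - y))\<^sup>2 + (1 - \<alpha>) / (1 + \<alpha>) * (norm (x - z))\<^sup>2 \<le> a\<^sup>2 + b\<^sup>2 - 2 * lam * s"
    unfolding zy by (simp add: algebra_simps)
  also have "\<dots> \<le> (1 + lam * \<epsilon>) / (1 - \<epsilon>) * (norm (x - y))\<^sup>2"
  proof -
    \<comment> \<open>After clearing the denominator, the right side minus the left side is exactly
      \<open>(1 + lam) * t\<close>.\<close>
    define t where "t = \<epsilon> * (a\<^sup>2 + b\<^sup>2) + 2 * s"
    have "2 * (a * b) \<le> a\<^sup>2 + b\<^sup>2"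
      using sum_squares_bound[of a b] by (simp add: algebra_simps)
    then have "\<epsilon> * (2 * (a * b)) \<le> \<epsilon> * (a\<^sup>2 + b\<^sup>2)"
      using \<epsilon> by (intro mult_left_mono) auto
    then have "t \<ge> 0" unfolding t_def using s by (simp add: algebra_simps)
    then have "(1 + lam) * t \<ge> 0" using lam by simp
    then have "(1 - \<epsilon>) * (a\<^sup>2 + b\<^sup>2 - 2 * lam * s) \<le> (1 + lam * \<epsilon>) * (a\<^sup>2 + 2 * s + b\<^sup>2)"
      unfolding t_def by (simp add: algebra_simps)
    then show ?thesis using \<epsilon> unfolding xy by (simp add: field_simps)
  qed
  also have "\<dots> \<le> (1 + \<alpha> * \<epsilon>) / (1 - \<epsilon>) * (norm (x - y))\<^sup>2"
    using \<epsilon> lam by (intro mult_right_mono divide_right_mono add_mono) auto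
  finally show ?thesis .
qed

section \<open>Path lengths, R-linear convergence and confinement of abstract sequences\<close>

lemma norm_path_le:
  fixes u :: "nat \<Rightarrow> 'a::real_normed_vector" and b :: "nat \<Rightarrow> real"
  assumes b: "\<And>i. i < N \<Longrightarrow> b i > 0" and k: "k \<le> N"
  shows "(norm (u 0 - u k))\<^sup>2 \<le> (\<Sum>i<N. 1 / b i) * (\<Sum>i<N. b i * (norm (u i - u (Suc i)))\<^sup>2)"
proof -
  have "u 0 - u k = (\<Sum>i<k. u i - u (Suc i))"
    by (simp add: sum_lessThan_telescope')
  then have "norm (u 0 - u k) \<le> (\<Sum>i<k. norm (u i - u (Suc i)))"
    by (simp add: norm_sum)
  also have "\<dots> \<le> (\<Sum>i<N. norm (u i - u (Suc i)))"
    using k by (intro sum_mono2) auto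
  \<comment> \<open>The inserted factors cancel here and become the weights \<open>1 / b i\<close>
    and \<open>b i\<close> after Cauchy-Schwarz.\<close>
  also have "\<dots> = (\<Sum>i<N. (1 / sqrt (b i)) * (sqrt (b i) * norm (u i - u (Suc i))))"
    proof (intro sum.cong refl)
    fix i assume "i \<in> {..<N}"
    then have "sqrt (b i) > 0" using b by simp
    then show "norm (u i - u (Suc i)) = 1 / sqrt (b i) * (sqrt (b i) * norm (u i - u (Suc i)))"
      by simp
  qed
  finally have "(norm (u 0 - u k))\<^sup>2 \<le> (\<Sum>i<N. (1 / sqrt (b i)) * (sqrt (b i) * norm (u i - u (Suc i))))\<^sup>2"
    by (intro power_mono) auto
  also have "\<dots> \<le> (\<Sum>i<N. (1 / sqrt (b i))\<^sup>2) * (\<Sum>i<N. (sqrt (b i) * norm (u i - u (Suc i)))\<^sup>2)"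
    by (rule Cauchy_Schwarz_ineq_sum)
  also have "\<dots> = (\<Sum>i<N. 1 / b i) * (\<Sum>i<N. b i * (norm (u i - u (Suc i)))\<^sup>2)"
  proof -
    have "(sqrt (b i))\<^sup>2 = b i" if "i < N" for i using b[OF that] by simp
    then show ?thesis
      by (auto simp: power_mult_distrib power_divide intro!: arg_cong2[of _ _ _ _ "(*)"] sum.cong)
  qed
  finally show ?thesis .
qed

lemma converges_R_linearly_of_steps:
  fixes x :: "nat \<Rightarrow> 'a::euclidean_space"
  assumes \<rho>: "0 < \<rho>" "\<rho> < 1" and step: "\<And>n. norm (x (Suc n) - x n) \<le> K * \<rho> ^ n"
  obtains xbar where "x \<longlonglongrightarrow> xbar" "converges_R_linearly x xbar \<rho>"
proof -
  have "0 \<le> K" using order_trans[OF norm_ge_zero step[of 0]] by simp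
  have dist: "norm (x (n + k) - x n) \<le> K / (1 - \<rho>) * \<rho> ^ n" for n k
  proof -
    \<comment> \<open>The exact finite geometric sum is kept because the weaker bound below is not
      inductive in \<open>k\<close>.\<close>
    have "norm (x (n + k) - x n) \<le> K / (1 - \<rho>) * (\<rho> ^ n - \<rho> ^ (n + k))"
    proof (induction k)
      case (Suc k)
      have "norm (x (n + Suc k) - x n) \<le> norm (x (Suc (n + k)) - x (n + k)) + norm (x (n + k) - x n)"
        using norm_triangle_ineq[of "x (Suc (n + k)) - x (n + k)" "x (n + k) - x n"] by simp
      also have "\<dots> \<le> K * \<rho> ^ (n + k) + K / (1 - \<rho>) * (\<rho> ^ n - \<rho> ^ (n + k))"
        by (intro add_mono step Suc)
      also have "\<dots> = K / (1 - \<rho>) * (\<rho> ^ n - \<rho> ^ (n + Suc k))"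
        using \<rho> by (simp add: field_simps)
      finally show ?case .
    qed simp
    also have "\<dots> \<le> K / (1 - \<rho>) * \<rho> ^ n"
      using \<rho> \<open>0 \<le> K\<close> by (intro mult_left_mono) auto
    finally show ?thesis .
  qed
  have lim0: "(\<lambda>n. K / (1 - \<rho>) * \<rho> ^ n) \<longlonglongrightarrow> 0"
    using \<rho> by (intro tendsto_mult_right_zero LIMSEQ_power_zero) auto
  have "Cauchy x"
  proof (rule CauchyI')
    fix e :: real assume "e > 0"
    then obtain N where N: "\<And>n. n \<ge> N \<Longrightarrow> K / (1 - \<rho>) * \<rho> ^ n < e"
      using order_tendstoD(2)[OF lim0] by (auto simp: eventually_sequentially)
    show "\<exists>M. \<forall>m\<ge>M. \<forall>n>m. dist (x m) (x n) < e"
    proof (intro exI allI impI)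
      fix m n assume "N \<le> m" "m < n"
      then show "dist (x m) (x n) < e"
        using dist[of m "n - m"] N[of m] by (simp add: dist_norm norm_minus_commute)
    qed
  qed
  then obtain xbar where lim: "x \<longlonglongrightarrow> xbar" using Cauchy_convergent convergent_def by blast
  have "norm (x n - xbar) \<le> K / (1 - \<rho>) * \<rho> ^ n" for n
  proof -
    have "(\<lambda>k. x (n + k) - x n) \<longlonglongrightarrow> xbar - x n"
      using LIMSEQ_ignore_initial_segment[OF lim, of n]
      by (intro tendsto_diff tendsto_const) (simp add: add.commute)
    then have "norm (xbar - x n) \<le> K / (1 - \<rho>) * \<rho> ^ n"
      by (rule Lim_norm_ubound[OF trivial_limit_sequentially]) (intro always_eventually allI dist)
    then show ?thesis by (simp add: norm_minus_commute)
  qed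
  then have "converges_R_linearly x xbar \<rho>"
    unfolding converges_R_linearly_def using \<rho> \<open>0 \<le> K\<close> by (auto intro!: exI[of _ "K / (1 - \<rho>)"])
  with lim show ?thesis by (rule that)
qed

text \<open>Contraction is known only from one block start to the next. In between, the distance to
  \<open>D\<close> at most triples per step, since \<open>infdist\<close> is 1-Lipschitz and a step
  is at most twice that distance. So the distances, and with them the steps, decay like
  \<open>\<rho> ^ n\<close>.\<close>

lemma converges_R_linearly_of_infdist_blocks:
  fixes x :: "nat \<Rightarrow> 'a::euclidean_space"
  assumes D: "closed D" "D \<noteq> {}" and \<rho>: "0 < \<rho>" "\<rho> < 1" and M: "M > 0"
    and step: "\<And>n. norm (x (Suc n) - x n) \<le> 2 * infdist (x n) D"
    and block: "\<And>k. infdist (x (n0 + Suc k * M)) D \<le> \<rho> ^ M * infdist (x (n0 + k * M)) D"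
  shows "\<exists>xbar\<in>D. converges_R_linearly x xbar \<rho>"
proof -
  define d where "d n = infdist (x n) D" for n
  have d0: "d n \<ge> 0" for n by (simp add: d_def infdist_nonneg)
  have d_Suc: "d (Suc n) \<le> 3 * d n" for n
    using infdist_triangle[of "x (Suc n)" D "x n"] step[of n] by (simp add: d_def dist_norm)
  have d_add: "d (n + l) \<le> 3 ^ l * d n" for n l
  proof (induction l)
    case (Suc l)
    then show ?case using d_Suc[of "n + l"] by simp
  qed simp
  have d_block: "d (n0 + k * M) \<le> \<rho> ^ (k * M) * d n0" for k
  proof (induction k)
    case (Suc k)
    have "d (n0 + Suc k * M) \<le> \<rho> ^ M * d (n0 + k * M)" using block by (simp add: d_def)
    also have "\<dots> \<le> \<rho> ^ M * (\<rho> ^ (k * M) * d n0)"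
      using \<rho> Suc by (intro mult_left_mono) auto
    finally show ?case by (simp add: power_add)
  qed simp
  \<comment> \<open>The sum covers the indices before \<open>n0\<close>. In the other term,
    \<open>3 ^ M\<close> pays for growth inside a block, and the exponent \<open>n0 + M\<close> for
    the offset of the block starts and for the position in the block.\<close>
  define K where "K = (\<Sum>n<n0. d n / \<rho> ^ n) + 3 ^ M * d n0 / \<rho> ^ (n0 + M)"
  have d_le: "d n \<le> K * \<rho> ^ n" for n
  proof (cases "n < n0")
    case True
    have "d n / \<rho> ^ n \<le> (\<Sum>n<n0. d n / \<rho> ^ n)"
      using True d0 \<rho> by (intro member_le_sum) auto
    also have "\<dots> \<le> K" using d0 \<rho> by (simp add: K_def)
    finally show ?thesis using \<rho> by (simp add: field_simps)
  next
    case False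
    define k l where "k = (n - n0) div M" and "l = (n - n0) mod M"
    have n: "n = n0 + k * M + l" using False by (simp add: k_def l_def)
    have l: "l < M" using M by (simp add: l_def)
    have "d n \<le> 3 ^ l * d (n0 + k * M)" using d_add n by metis
    also have "\<dots> \<le> 3 ^ M * (\<rho> ^ (k * M) * d n0)"
      using l \<rho> d0 by (intro mult_mono d_block power_increasing) auto
    also have "\<dots> = 3 ^ M * d n0 / \<rho> ^ (n0 + M) * \<rho> ^ (n0 + k * M + M)"
      using \<rho> by (simp add: power_add)
    also have "\<dots> \<le> 3 ^ M * d n0 / \<rho> ^ (n0 + M) * \<rho> ^ n"
      using \<rho> d0 l by (intro mult_left_mono power_decreasing) (auto simp: n)
    also have "\<dots> \<le> K * \<rho> ^ n"
      using \<rho> d0 by (intro mult_right_mono) (auto simp: K_def intro!: sum_nonneg)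
    finally show ?thesis .
  qed
  have "norm (x (Suc n) - x n) \<le> (2 * K) * \<rho> ^ n" for n
    using step[of n] d_le[of n] by (simp add: d_def)
  then obtain xbar where lim: "x \<longlonglongrightarrow> xbar" and xbar: "converges_R_linearly x xbar \<rho>"
    using converges_R_linearly_of_steps[OF \<rho>] by metis
  have "(\<lambda>n. K * \<rho> ^ n) \<longlonglongrightarrow> 0"
    using \<rho> by (intro tendsto_mult_right_zero LIMSEQ_power_zero) auto
  then have "d \<longlonglongrightarrow> 0"
    by (rule tendsto_sandwich[rotated 3, OF _ ]) (use d0 d_le in auto)
  moreover have "d \<longlonglongrightarrow> infdist xbar D"
    unfolding d_def by (intro tendsto_infdist lim)
  ultimately have "infdist xbar D = 0" by (rule LIMSEQ_unique[rotated])
  then have "xbar \<in> D" using D in_closed_iff_infdist_zero by blast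
  with xbar show ?thesis by blast
qed

text \<open>The points \<open>y\<close> are tracked instead of the iterates: consecutive ones are at most
  \<open>2 * q ^ (k + 1) * a * r\<close> apart, which avoids losing a factor \<open>B\<close> per block.\<close>

lemma iterates_stay_in_ball:
  fixes x :: "nat \<Rightarrow> 'a::euclidean_space"
  assumes D: "closed D" "w \<in> D"
    and q: "0 \<le> q" "q < 1" and a: "0 \<le> a" and B: "1 \<le> B" and r: "0 \<le> r"
    and init: "\<And>l. l \<le> n0 \<Longrightarrow> (\<And>i. i < l \<Longrightarrow> x i \<in> cball w R) \<Longrightarrow> norm (x l - w) \<le> a * r"
    and within: "\<And>k l y. l < M \<Longrightarrow> (\<And>i. i < l \<Longrightarrow> x (n0 + k * M + i) \<in> cball w R) \<Longrightarrow>
      y \<in> D \<Longrightarrow> y \<in> cball w (2 * R) \<Longrightarrow>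
      norm (x (n0 + k * M + l) - y) \<le> B * norm (x (n0 + k * M) - y)"
    and contract: "\<And>k y. (\<And>i. i < n0 + k * M + M \<Longrightarrow> x i \<in> cball w R) \<Longrightarrow>
      y \<in> projector D (x (n0 + k * M)) \<Longrightarrow>
      norm (x (n0 + k * M + M) - y) \<le> q * norm (x (n0 + k * M) - y)"
    and R1: "a * B * r \<le> R" and R2: "(2 * a / (1 - q) + a * B * q) * r \<le> R" and M: "M > 0"
  shows "x n \<in> cball w R"
proof -
  have ball: "z \<in> cball w R \<longleftrightarrow> norm (z - w) \<le> R" for z
    by (simp add: dist_norm norm_minus_commute)
  define s where "s = a * r"
  have s: "0 \<le> s" using a r by (simp add: s_def)
  have sR: "s \<le> R"
    using R1 B s mult_left_mono[of 1 B s] by (simp add: s_def algebra_simps)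
  have sR2: "2 * s / (1 - q) + B * (q * s) \<le> R" using R2 by (simp add: s_def algebra_simps)
  have R0: "0 \<le> R" using s sR by simp
  have x0: "norm (x n0 - w) \<le> s" "\<And>i. i < n0 \<Longrightarrow> x i \<in> cball w R"
  proof -
    \<comment> \<open>Strong induction, since \<open>init\<close> at \<open>l\<close> presupposes
      that all earlier iterates lie in the ball.\<close>
    have *: "l \<le> n0 \<longrightarrow> norm (x l - w) \<le> s" for l
    proof (induction l rule: less_induct)
      case (less l)
      show ?case
      proof
        assume "l \<le> n0"
        then have "x i \<in> cball w R" if "i < l" for i
          unfolding ball using less[OF that] that sR by simp
        then show "norm (x l - w) \<le> s" using init \<open>l \<le> n0\<close> by (simp add: s_def)
      qed
    qed
    then show "norm (x n0 - w) \<le> s" by simp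
    fix i assume "i < n0"
    then show "x i \<in> cball w R" unfolding ball using *[of i] sR by simp
  qed
  have geo: "(\<Sum>i\<le>k. q ^ i) \<le> 1 / (1 - q)" for k
    using q by (simp add: sum_gp0 divide_right_mono)
  \<comment> \<open>The invariant joins confinement before a block start with a bound on the drift
    of the tracked projection \<open>y\<close> by a partial geometric sum.\<close>
  have "(\<forall>i < n0 + k * M. x i \<in> cball w R) \<and>
    (\<exists>y \<in> projector D (x (n0 + k * M)). norm (x (n0 + k * M) - y) \<le> q ^ k * s
      \<and> norm (y - w) \<le> 2 * s * (\<Sum>i\<le>k. q ^ i))" for k
  proof (induction k)
    case 0
    obtain y where y: "y \<in> projector D (x n0)" using projector_nonempty D by blast
    have "norm (x n0 - y) \<le> s" using projector_norm_le[OF y] D x0(1) by fastforce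
    moreover have "norm (y - w) \<le> 2 * s" using projector_norm_diff_le[OF y] D x0(1) by fastforce
    ultimately show ?case using x0(2) y by auto
  next
    case (Suc k)
    define n where "n = n0 + k * M"
    from Suc obtain y where prev: "\<forall>i < n. x i \<in> cball w R" and y: "y \<in> projector D (x n)"
      and xy: "norm (x n - y) \<le> q ^ k * s" and yw: "norm (y - w) \<le> 2 * s * (\<Sum>i\<le>k. q ^ i)"
      by (auto simp: n_def)
    have yw': "norm (y - w) \<le> 2 * s / (1 - q)"
      using order_trans[OF yw mult_left_mono[OF geo]] s by simp
    have "l < M \<longrightarrow> x (n + l) \<in> cball w R" for l
    proof (induction l rule: less_induct)
      case (less l)
      show ?case
      proof
        assume "l < M"
        then have before: "x (n + i) \<in> cball w R" if "i < l" for i using less that by simp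
        show "x (n + l) \<in> cball w R"
        \<comment> \<open>The first block is measured from \<open>w\<close> itself, which is covered
          by \<open>R1\<close>. Later blocks are measured from \<open>y\<close>; they have gained at
          least one factor \<open>q\<close>, which is what \<open>R2\<close> asks for.\<close>
        proof (cases "k = 0")
          case True
          have "norm (x (n + l) - w) \<le> B * norm (x n - w)"
            using within[of l k w] before \<open>l < M\<close> D R0 by (simp add: n_def)
          also have "\<dots> \<le> B * s" using x0 True B by (simp add: n_def)
          finally show ?thesis unfolding ball using R1 by (simp add: s_def algebra_simps)
        next
          case False
          then have "q ^ k * s \<le> q * s"
            using q s power_decreasing[of 1 k q] by (intro mult_right_mono) auto
          then have xy': "norm (x n - y) \<le> q * s" using xy by simp
          have "0 \<le> B * (q * s)" using B q s by simp
          then have "norm (y - w) \<le> 2 * R" using yw' sR2 R0 by linarith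
          then have "norm (x (n + l) - y) \<le> B * norm (x n - y)"
            using within[of l k y] before \<open>l < M\<close> projectorD(1)[OF y]
            by (simp add: n_def dist_norm norm_minus_commute)
          also have "\<dots> \<le> B * (q * s)" using xy' B by simp
          finally have "norm (x (n + l) - w) \<le> R"
            using norm_triangle_ineq[of "x (n + l) - y" "y - w"] yw' sR2 by simp
          then show ?thesis unfolding ball .
        qed
      qed
    qed
    then have blk: "x (n + l) \<in> cball w R" if "l < M" for l using that by blast
    have upto: "x i \<in> cball w R" if "i < n + M" for i
    proof (cases "i < n")
      case False
      then show ?thesis using blk[of "i - n"] that by simp
    qed (use prev in auto)
    have 4: "\<forall>i < n + M. x i \<in> cball w R" using upto by blast
    have "norm (x (n + M) - y) \<le> q * norm (x n - y)"
      using contract[of k y] upto y by (simp add: n_def)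
    also have "\<dots> \<le> q ^ Suc k * s" using mult_left_mono[OF xy, of q] q by simp
    finally have 1: "norm (x (n + M) - y) \<le> q ^ Suc k * s" .
    obtain y' where y': "y' \<in> projector D (x (n + M))" using projector_nonempty D by blast
    have 2: "norm (x (n + M) - y') \<le> q ^ Suc k * s"
      using projector_norm_le[OF y' projectorD(1)[OF y]] 1 by simp
    \<comment> \<open>Both \<open>y\<close> and \<open>y'\<close> are within
      \<open>q ^ Suc k * s\<close> of \<open>x (n + M)\<close>, so the drift grows by just the next
      term of the geometric sum.\<close>
    have "norm (y' - w) \<le> norm (y' - x (n + M)) + norm (x (n + M) - y) + norm (y - w)"
      using norm_triangle_ineq[of "y' - x (n + M)" "x (n + M) - y"]
        norm_triangle_ineq[of "y' - y" "y - w"] by simp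
    also have "\<dots> \<le> q ^ Suc k * s + q ^ Suc k * s + 2 * s * (\<Sum>i\<le>k. q ^ i)"
      using 1 2 yw by (intro add_mono) (auto simp: norm_minus_commute)
    also have "\<dots> = 2 * s * (\<Sum>i\<le>Suc k. q ^ i)" by (simp add: algebra_simps)
    finally have 3: "norm (y' - w) \<le> 2 * s * (\<Sum>i\<le>Suc k. q ^ i)" .
    have "n0 + Suc k * M = n + M" by (simp add: n_def)
    then show ?case using 2 3 4 y' by metis
  qed
  moreover have "n < n0 + Suc n * M" using M by (cases M) auto
  ultimately show ?thesis by blast
qed

section \<open>The setting and the cyclic order of the operators\<close>

locale semi_intrepid_system =
  fixes m :: nat and C :: "nat \<Rightarrow> 'a::euclidean_space set" and w :: 'a
    and \<epsilon> \<delta> \<kappa> \<Gamma> \<rho> \<delta>' :: real and \<tau> \<alpha> \<gamma> :: "nat \<Rightarrow> real" and J :: "nat set"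
  assumes m: "m \<ge> 2"
    and J: "J = {j \<in> {1..m}. \<alpha> j = 1}" "card J \<le> 1"
    and \<gamma>: "\<And>i. i \<in> {1..m} \<Longrightarrow> \<gamma> i = (1 + \<alpha> i * \<epsilon>) / (1 - \<epsilon>)"
    and \<Gamma>: "\<Gamma> = sqrt ((\<Prod>i\<in>{1..m}. \<gamma> i) / (MIN i\<in>{1..m}. \<gamma> i ^ (1 - card J)))"
    and \<rho>: "\<rho> = (max 0
            (\<Gamma>\<^sup>2 - 1 / \<kappa>\<^sup>2
               * inverse ((\<Sum>i\<in>{1..m} - J. (1 + \<alpha> i) / (1 - \<alpha> i))
                   - (1 - real (card J)) * (MIN i\<in>{1..m} - J. (1 + \<alpha> i) / (1 - \<alpha> i)))
               * ((1 + \<epsilon>) / (1 - \<epsilon>)) ^ card J))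
          powr (1 / (2 * (real m - 1 + real (card J))))"
    and \<delta>': "\<delta>' = \<delta> / (2 * \<Gamma>) * (MIN i\<in>{1..m}. sqrt (\<gamma> i))
               * (MAX i\<in>{1..m}. sqrt (\<gamma> i)) powi (int (card J) - 1)"
    and closed: "\<And>i. i \<in> {1..m} \<Longrightarrow> closed (C i)"
    and w: "\<And>i. i \<in> {1..m} \<Longrightarrow> w \<in> C i"
    and \<epsilon>: "0 < \<epsilon>" "\<epsilon> < 1" and \<delta>: "\<delta> > 0" and \<kappa>: "\<kappa> > 0" and \<rho>_less_1: "\<rho> < 1"
    and \<tau>: "\<And>i. i \<in> {1..m} \<Longrightarrow> \<tau> i \<ge> 0"
    and \<alpha>: "\<And>i. i \<in> {1..m} \<Longrightarrow> 0 \<le> \<alpha> i" "\<And>i. i \<in> {1..m} \<Longrightarrow> \<alpha> i \<le> 1"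
    and lin_regular: "linearly_regular_on \<kappa> {1..m} C (cball w (\<delta> / 2))"
    and regular: "\<And>i. i \<in> {1..m} \<Longrightarrow> regular_at \<epsilon> \<delta> (C i) w"
    and injectable: "\<And>i. i \<in> {1..m} \<Longrightarrow> injectable_on (\<tau> i) (C i) (cball w (\<delta> / 2))"
begin

abbreviation "I \<equiv> {1..m}"
text \<open>This is the operator leading from \<open>x n\<close> to
  \<open>x (Suc n)\<close>.\<close>

definition idx :: "nat \<Rightarrow> nat" where "idx n = n mod m + 1"

abbreviation "U \<equiv> cball w (\<delta> / 2)"
abbreviation "\<beta> i \<equiv> (1 - \<alpha> i) / (1 + \<alpha> i)"

definition D :: "'a set" where "D = (\<Inter>i\<in>I. C i)"

lemma idx: "idx n \<in> I"
  using m mod_less_divisor[of m n] by (simp add: idx_def Suc_le_eq del: mod_less_divisor)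

lemma idx_add_m: "idx (n + m) = idx n"
  by (simp add: idx_def)

lemma D_closed: "closed D" and w_D: "w \<in> D" and D_nonempty: "D \<noteq> {}"
proof -
  show "closed D" using closed unfolding D_def by (intro closed_INT) blast
  show "w \<in> D" using w by (simp add: D_def)
  then show "D \<noteq> {}" by blast
qed

lemma D_subset: "i \<in> I \<Longrightarrow> D \<subseteq> C i"
  by (auto simp: D_def)

lemma \<gamma>_gt_1:
  assumes "i \<in> I"
  shows "\<gamma> i > 1"
proof -
  have "\<alpha> i * \<epsilon> \<ge> 0" using \<alpha>(1)[OF assms] \<epsilon> by simp
  then have "1 - \<epsilon> < 1 + \<alpha> i * \<epsilon>" using \<epsilon> by linarith
  then show ?thesis unfolding \<gamma>[OF assms] using \<epsilon> by (simp add: less_divide_eq)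
qed

lemma \<beta>_nonneg: "i \<in> I \<Longrightarrow> \<beta> i \<ge> 0"
  using \<alpha>[of i] by simp

text \<open>Offsets below \<open>m\<close> with equal residues differ by a multiple of
  \<open>m\<close> smaller than \<open>m\<close>.\<close>

lemma inj_on_idx:
  assumes "l \<le> m"
  shows "inj_on (\<lambda>i. idx (n + i)) {..<l}"
proof (rule inj_onI)
  have *: "i = j" if "i \<le> j" "j < m" "(n + i) mod m = (n + j) mod m" for i j
  proof -
    have "m dvd (n + j) - (n + i)" using that mod_eq_dvd_iff_nat[of "n + i" "n + j" m] by simp
    then show ?thesis using that by (auto dest: dvd_imp_le)
  qed
  fix i j assume "i \<in> {..<l}" "j \<in> {..<l}" "idx (n + i) = idx (n + j)"
  then show "i = j" unfolding idx_def using *[of i j] *[of j i] assms by (cases "i \<le> j") auto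
qed

lemma prod_idx:
  fixes f :: "nat \<Rightarrow> real"
  assumes "l \<le> m"
  shows "(\<Prod>i<l. f (idx (n + i))) = prod f ((\<lambda>i. idx (n + i)) ` {..<l})"
  using prod.reindex[OF inj_on_idx[OF assms, of n], of f] by (simp add: comp_def)

lemma sum_idx:
  fixes f :: "nat \<Rightarrow> real"
  assumes "l \<le> m"
  shows "(\<Sum>i<l. f (idx (n + i))) = sum f ((\<lambda>i. idx (n + i)) ` {..<l})"
  using sum.reindex[OF inj_on_idx[OF assms, of n], of f] by (simp add: comp_def)

lemma idx_image_full: "(\<lambda>i. idx (n + i)) ` {..<m} = I"
proof (rule card_subset_eq)
  show "(\<lambda>i. idx (n + i)) ` {..<m} \<subseteq> I" using idx by blast
  show "card ((\<lambda>i. idx (n + i)) ` {..<m}) = card I"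
    using card_image[OF inj_on_idx[of m n]] by simp
qed simp

text \<open>Of the \<open>m\<close> operators following step \<open>n\<close>, the last is
  \<open>idx (n + m) = idx n\<close>. Dropping it leaves a block that visits every set except the
  one just projected on.\<close>

lemma idx_image_all_but_last: "(\<lambda>i. idx (Suc n + i)) ` {..<m - 1} = I - {idx n}"
proof -
  define f where "f i = idx (Suc n + i)" for i
  have "inj_on f {..<m}" unfolding f_def by (rule inj_on_idx) simp
  moreover have "{..<m - 1} = {..<m} - {m - 1}" by auto
  ultimately have "f ` {..<m - 1} = f ` {..<m} - f ` {m - 1}"
    using m inj_on_image_set_diff[of f "{..<m}" "{..<m}" "{m - 1}"] by auto
  moreover have "f ` {..<m} = I" using idx_image_full[of "Suc n"] by (simp add: f_def)
  moreover have "f (m - 1) = idx n" using m idx_add_m[of n] by (simp add: f_def add.commute)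
  ultimately show ?thesis by (simp add: f_def)
qed

text \<open>\<open>D\<close> lies in every \<open>C i\<close>, so the maximal distance is at most
  the distance to \<open>D\<close>; for \<open>\<kappa> < 1\<close> linear regularity then forces
  the latter to vanish.\<close>

lemma ball_subset_of_linearly_regular:
  assumes "\<kappa> < 1"
  shows "U \<subseteq> D"
proof
  fix z assume z: "z \<in> U"
  have "(MAX i\<in>I. infdist z (C i)) \<le> infdist z D"
    using m infdist_mono[OF D_subset D_nonempty] by (subst Max_le_iff) auto
  then have "\<kappa> * (MAX i\<in>I. infdist z (C i)) \<le> \<kappa> * infdist z D" using \<kappa> by simp
  moreover have "infdist z D \<le> \<kappa> * (MAX i\<in>I. infdist z (C i))"
    using lin_regular z by (auto simp: linearly_regular_on_def D_def)
  ultimately have "(1 - \<kappa>) * infdist z D \<le> 0" by (simp add: algebra_simps)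
  then have "infdist z D \<le> 0" using assms by (simp add: mult_le_0_iff)
  then have "infdist z D = 0" using infdist_nonneg[of z D] by linarith
  then show "z \<in> D" using in_closed_iff_infdist_zero[OF D_closed D_nonempty] by blast
qed

section \<open>Block length and growth constants\<close>

abbreviation "M \<equiv> m - 1 + card J"

lemma M_pos: "M > 0"
  using m by simp

lemma J_cases:
  obtains "J = {}" "card J = 0" | j where "j \<in> I" "J = {j}" "card J = 1"
proof (cases "card J = 0")
  case True
  then show ?thesis using that(1) J by simp
next
  case False
  then have "card J = 1" using J(2) by simp
  then obtain j where "J = {j}" by (auto simp: card_1_singleton_iff)
  then show ?thesis using that(2) \<open>card J = 1\<close> J(1) by blast
qed

definition "lo = (MIN i\<in>I. \<gamma> i)"
definition "hi = (MAX i\<in>I. sqrt (\<gamma> i))"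

lemma I_nonempty: "I \<noteq> {}"
  using m by auto

lemma lo_le: "i \<in> I \<Longrightarrow> lo \<le> \<gamma> i"
  by (simp add: lo_def)

lemma lo_gt_1: "lo > 1"
  unfolding lo_def using I_nonempty \<gamma>_gt_1 by (subst Min_gr_iff) auto

lemma sqrt_lo: "(MIN i\<in>I. sqrt (\<gamma> i)) = sqrt lo"
proof -
  have "mono sqrt" by (simp add: mono_def)
  then show ?thesis
    unfolding lo_def using I_nonempty by (subst mono_Min_commute) (auto simp: image_image)
qed

lemma sqrt_\<gamma>_le_hi: "i \<in> I \<Longrightarrow> sqrt (\<gamma> i) \<le> hi"
  by (simp add: hi_def)

lemma hi_ge_1: "hi \<ge> 1"
proof -
  obtain i where i: "i \<in> I" using I_nonempty by blast
  have "1 \<le> sqrt (\<gamma> i)" using \<gamma>_gt_1[OF i] by simp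
  also have "\<dots> \<le> hi" using sqrt_\<gamma>_le_hi[OF i] .
  finally show ?thesis .
qed

lemma \<gamma>_pos: "i \<in> I \<Longrightarrow> \<gamma> i > 0"
  using \<gamma>_gt_1[of i] by linarith

text \<open>At least \<open>k\<close> factors lie outside \<open>S\<close>, and each of them is at
  least \<open>lo > 1\<close>.\<close>

lemma prod_subset_le:
  assumes "S \<subseteq> I" "card S + k \<le> m"
  shows "prod \<gamma> S * lo ^ k \<le> prod \<gamma> I"
proof -
  have fin: "finite S" using assms(1) finite_subset by blast
  have "k \<le> card (I - S)" using assms card_Diff_subset[OF fin assms(1)] by simp
  then have "lo ^ k \<le> lo ^ card (I - S)" using lo_gt_1 by (intro power_increasing) auto
  also have "\<dots> = (\<Prod>i\<in>I - S. lo)" by simp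
  also have "\<dots> \<le> prod \<gamma> (I - S)" using lo_le lo_gt_1 by (intro prod_mono) auto
  finally have "lo ^ k \<le> prod \<gamma> (I - S)" .
  moreover have "0 \<le> prod \<gamma> S"
    using assms(1) \<gamma>_pos by (intro prod_nonneg) (auto simp: less_imp_le)
  ultimately have "prod \<gamma> S * lo ^ k \<le> prod \<gamma> S * prod \<gamma> (I - S)" by (rule mult_left_mono)
  also have "\<dots> = prod \<gamma> I" using prod.subset_diff[OF assms(1), of \<gamma>] by (simp add: mult.commute)
  finally show ?thesis .
qed

lemma prod_I_pos: "prod \<gamma> I > 0"
  using \<gamma>_pos by (intro prod_pos) auto

text \<open>For \<open>card J = 1\<close> the minimum runs over the constant 1; for empty
  \<open>J\<close> it is \<open>lo\<close>. Both are the same power of \<open>lo\<close>.\<close>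

lemma \<Gamma>_sq: "\<Gamma>\<^sup>2 * lo ^ (1 - card J) = prod \<gamma> I"
proof -
  have eq: "(MIN i\<in>I. \<gamma> i ^ (1 - card J)) = lo ^ (1 - card J)"
    by (cases rule: J_cases) (use I_nonempty in \<open>simp_all add: lo_def image_constant_conv\<close>)
  have "lo ^ (1 - card J) > 0" using lo_gt_1 by simp
  moreover from this have "\<Gamma>\<^sup>2 = prod \<gamma> I / lo ^ (1 - card J)"
    unfolding \<Gamma> eq using prod_I_pos by (intro real_sqrt_pow2 divide_nonneg_nonneg) auto
  ultimately show ?thesis by (metis less_irrefl nonzero_eq_divide_eq)
qed

text \<open>\<open>Bd\<close> bounds the growth of the distance to points of \<open>D\<close> over at most \<open>M - 1\<close> steps.\<close>

definition "Bd = \<Gamma> / sqrt lo"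

lemma \<Gamma>_pos: "\<Gamma> > 0"
proof -
  have "0 \<le> (MIN i\<in>I. \<gamma> i ^ (1 - card J))"
    using I_nonempty \<gamma>_pos
    by (intro Min.boundedI) (auto intro!: zero_le_power less_imp_le)
  then have "\<Gamma> \<ge> 0" unfolding \<Gamma> using prod_I_pos
    by (intro real_sqrt_ge_zero divide_nonneg_nonneg) auto
  moreover have "\<Gamma> \<noteq> 0" using \<Gamma>_sq prod_I_pos by (metis less_irrefl mult_zero_left zero_power2)
  ultimately show ?thesis by simp
qed

lemma Bd_sqrt_lo: "Bd * sqrt lo = \<Gamma>"
  using lo_gt_1 by (simp add: Bd_def)

lemma Bd_pos: "Bd > 0"
  using \<Gamma>_pos lo_gt_1 by (simp add: Bd_def)

lemma Bd_sq: "Bd\<^sup>2 * lo ^ (2 - card J) = prod \<gamma> I"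
proof -
  have "Bd\<^sup>2 * lo = (Bd * sqrt lo)\<^sup>2" using lo_gt_1 by (simp add: power_mult_distrib)
  then have "Bd\<^sup>2 * lo = \<Gamma>\<^sup>2" unfolding Bd_sqrt_lo .
  moreover have "2 - card J = Suc (1 - card J)" using J(2) by simp
  ultimately show ?thesis using \<Gamma>_sq by (simp add: mult.assoc[symmetric])
qed

text \<open>Fewer than \<open>M\<close> factors leave out at least \<open>2 - card J\<close> of all
  \<open>m\<close>, and that many powers of \<open>lo\<close> separate \<open>Bd\<^sup>2\<close>
  from the full product.\<close>

lemma prod_le_Bd_sq:
  assumes "S \<subseteq> I" "card S < M"
  shows "prod \<gamma> S \<le> Bd\<^sup>2"
proof -
  have "card S + (2 - card J) \<le> m" using assms(2) J(2) m by simp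
  then have "prod \<gamma> S * lo ^ (2 - card J) \<le> Bd\<^sup>2 * lo ^ (2 - card J)"
    using prod_subset_le[OF assms(1)] Bd_sq by simp
  then show ?thesis using lo_gt_1 by simp
qed

lemma Bd_ge_1: "Bd \<ge> 1"
proof -
  have "1 \<le> Bd\<^sup>2" using prod_le_Bd_sq[of "{}"] M_pos by simp
  then show ?thesis using Bd_pos power2_le_imp_le[of 1 Bd] by simp
qed

lemma \<Gamma>_ge_1: "\<Gamma> \<ge> 1"
  using mult_mono[of 1 Bd 1 "sqrt lo"] Bd_ge_1 lo_gt_1 unfolding Bd_sqrt_lo by simp

lemma sqrt_lo_le_Bd:
  assumes "card J = 1"
  shows "sqrt lo \<le> Bd"
proof -
  have "prod \<gamma> {1} \<le> Bd\<^sup>2" using assms m by (intro prod_le_Bd_sq) auto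
  moreover have "lo \<le> \<gamma> 1" using m by (intro lo_le) simp
  ultimately have "lo \<le> Bd\<^sup>2" by simp
  then show ?thesis using Bd_pos real_le_lsqrt[of lo Bd] real_sqrt_le_mono[of lo "Bd\<^sup>2"] by simp
qed

text \<open>\<open>\<delta>'\<close> is scaled so that growth by \<open>Bd\<close>, and by one more
  \<open>hi\<close> if \<open>J\<close> is empty, ends exactly at radius
  \<open>\<delta> / 2\<close>.\<close>

lemma half_\<delta>: "\<delta> / 2 = \<delta>' * Bd * hi ^ (1 - card J)"
  using lo_gt_1 hi_ge_1 \<Gamma>_pos unfolding \<delta>' sqrt_lo hi_def[symmetric] Bd_def
  by (cases rule: J_cases) (simp_all add: power_int_minus)

lemma \<delta>'_pos: "\<delta>' > 0"
  unfolding \<delta>' sqrt_lo hi_def[symmetric]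
  using lo_gt_1 hi_ge_1 \<Gamma>_pos \<delta> by (intro mult_pos_pos zero_less_power_int divide_pos_pos) auto

lemma \<delta>'_le: "\<delta>' * Bd \<le> \<delta> / 2" "\<delta>' \<le> \<delta> / 2"
proof -
  have "\<delta>' * Bd * 1 \<le> \<delta>' * Bd * hi ^ (1 - card J)"
    using \<delta>'_pos Bd_pos hi_ge_1 by (intro mult_left_mono one_le_power) auto
  then show "\<delta>' * Bd \<le> \<delta> / 2" by (simp add: half_\<delta>)
  moreover have "\<delta>' * 1 \<le> \<delta>' * Bd" using Bd_ge_1 \<delta>'_pos by (intro mult_left_mono) auto
  ultimately show "\<delta>' \<le> \<delta> / 2" by linarith
qed

section \<open>The starting radius and its two confinement conditions\<close>

lemma \<rho>_nonneg: "\<rho> \<ge> 0"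
  by (simp add: \<rho>)

definition "r = \<delta>' * (1 - \<rho>) / (2 + \<Gamma> - \<rho>)"

lemma denominator_pos: "2 + \<Gamma> - \<rho> > 0"
  using \<Gamma>_pos \<rho>_less_1 by simp

lemma r_pos: "r > 0"
  using \<delta>'_pos \<rho>_less_1 denominator_pos by (simp add: r_def)

lemma r_le: "r \<le> \<delta>'" "\<Gamma> * r \<le> \<delta>'"
proof -
  have "\<delta>' * (1 - \<rho>) \<le> \<delta>' * (2 + \<Gamma> - \<rho>)"
    using \<delta>'_pos \<Gamma>_pos by (intro mult_left_mono) auto
  then show "r \<le> \<delta>'" unfolding r_def using denominator_pos by (simp add: pos_divide_le_eq)
  have "0 \<le> \<Gamma> * \<rho>" using \<Gamma>_pos \<rho>_nonneg by simp
  then have "\<Gamma> * (1 - \<rho>) \<le> 2 + \<Gamma> - \<rho>"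
    unfolding right_diff_distrib using \<rho>_less_1 by linarith
  then have "\<delta>' * (\<Gamma> * (1 - \<rho>)) \<le> \<delta>' * (2 + \<Gamma> - \<rho>)"
    using \<delta>'_pos by (intro mult_left_mono) auto
  then show "\<Gamma> * r \<le> \<delta>'"
    unfolding r_def using denominator_pos by (simp add: pos_divide_le_eq algebra_simps)
qed

text \<open>Growth of the distance to \<open>w\<close> up to the first block start: one step if
  \<open>J\<close> is empty, otherwise up to \<open>m\<close> steps until the reflecting operator
  has been applied.\<close>

definition "a = (if card J = 0 then hi else \<Gamma>)"

lemma a_nonneg: "a \<ge> 0"
  using hi_ge_1 \<Gamma>_pos by (simp add: a_def)

text \<open>Condition \<open>R1\<close> of \<open>iterates_stay_in_ball\<close>, with
  \<open>B = Bd\<close> and \<open>R = \<delta> / 2\<close>.\<close>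

lemma radius_first_block: "a * Bd * r \<le> \<delta> / 2"
proof (cases rule: J_cases)
  case 1
  have "hi * Bd * r \<le> hi * Bd * \<delta>'"
    using r_le hi_ge_1 Bd_pos by (intro mult_left_mono) auto
  then show ?thesis using 1(2) by (simp add: a_def half_\<delta> algebra_simps)
next
  case 2
  have "Bd * (\<Gamma> * r) \<le> Bd * \<delta>'" using r_le Bd_pos by (intro mult_left_mono) auto
  then show ?thesis using 2(3) by (simp add: a_def half_\<delta> algebra_simps)
qed

text \<open>Condition \<open>R2\<close>, applied with \<open>q = \<rho> ^ M\<close>. The numerator
  \<open>1 - \<rho>\<close> of \<open>r\<close> absorbs \<open>1 / (1 - q)\<close>, which leaves an
  inequality against the denominator of \<open>r\<close>.\<close>

lemma radius_later_blocks:
  assumes q: "0 \<le> q" "q \<le> \<rho>"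
  shows "(2 * a / (1 - q) + a * Bd * q) * r \<le> \<delta> / 2"
proof -
  define h where "h = hi ^ (1 - card J)"
  have "(1 - \<rho>) / (1 - q) \<le> 1" using q \<rho>_less_1 by simp
  moreover have "Bd * q * (1 - \<rho>) \<le> Bd * \<rho> * (1 - \<rho>)"
    using q Bd_pos \<rho>_less_1 by (intro mult_right_mono mult_left_mono) auto
  moreover have "(2 / (1 - q) + Bd * q) * (1 - \<rho>) = 2 * ((1 - \<rho>) / (1 - q)) + Bd * q * (1 - \<rho>)"
    by (simp add: distrib_right)
  ultimately have lhs: "(2 / (1 - q) + Bd * q) * (1 - \<rho>) \<le> 2 + Bd * \<rho> * (1 - \<rho>)" by linarith
  have key: "a * (2 + Bd * \<rho> * (1 - \<rho>)) \<le> h * Bd * (2 + \<Gamma> - \<rho>)"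
  proof (cases rule: J_cases)
    case 1
    have "Bd * (\<rho> * (1 - \<rho>)) \<le> Bd * (1 - \<rho>)"
      using Bd_pos \<rho>_nonneg \<rho>_less_1 by (intro mult_left_mono mult_left_le_one_le) auto
    moreover have "Bd * 1 \<le> Bd * \<Gamma>" using Bd_pos \<Gamma>_ge_1 by (intro mult_left_mono) auto
    moreover have "Bd * (2 + \<Gamma> - \<rho>) = Bd + Bd * \<Gamma> + Bd * (1 - \<rho>)" by (simp add: algebra_simps)
    moreover have "Bd * \<rho> * (1 - \<rho>) = Bd * (\<rho> * (1 - \<rho>))" by simp
    ultimately have "2 + Bd * \<rho> * (1 - \<rho>) \<le> Bd * (2 + \<Gamma> - \<rho>)"
      using Bd_ge_1 by linarith
    then show ?thesis using hi_ge_1 1(2)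
      by (simp add: a_def h_def mult.assoc)
  next
    case 2
    txt \<open>The bound \<open>s * (2 - \<rho>) \<ge> 1\<close> makes the quadratic \<open>s * g\<^sup>2 - 2 * g + (2 - \<rho>)\<close> nonnegative.\<close>
    define g s where "g = sqrt lo" and "s = 1 - \<rho> + \<rho>\<^sup>2"
    have g: "0 < g" "g \<le> Bd" using lo_gt_1 sqrt_lo_le_Bd[OF 2(3)] by (auto simp: g_def)
    have s: "s > 0" using \<rho>_less_1 zero_le_power2[of \<rho>] unfolding s_def by linarith
    have "s * (2 - \<rho>) = 1 + (1 - \<rho>) ^ 3"
      by (simp add: s_def power2_eq_square power3_eq_cube algebra_simps)
    moreover have "(1 - \<rho>) ^ 3 \<ge> 0" using \<rho>_less_1 by simp
    \<comment> \<open>Completing the square: the two sides differ by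
      \<open>s * (2 - \<rho>) - 1\<close>.\<close>
    ultimately have "s * ((2 - \<rho>) + g\<^sup>2 * s - 2 * g) \<ge> (1 - g * s)\<^sup>2"
      by (simp add: power2_eq_square algebra_simps)
    then have "s * ((2 - \<rho>) + g\<^sup>2 * s - 2 * g) \<ge> 0" using zero_le_power2 order_trans by blast
    then have "2 * g \<le> (2 - \<rho>) + g\<^sup>2 * s" using s by (simp add: zero_le_mult_iff)
    \<comment> \<open>Only one of the two factors \<open>g\<close> is enlarged to \<open>Bd\<close>,
      so that \<open>Bd * g = \<Gamma>\<close> appears.\<close>
    also have "\<dots> \<le> (2 - \<rho>) + Bd * g * s"
      using g s by (simp add: power2_eq_square mult_right_mono)
    finally have "Bd * (2 * g) \<le> Bd * ((2 - \<rho>) + Bd * g * s)"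
      using Bd_pos by (intro mult_left_mono) auto
    then have "(Bd * g) * (2 + Bd * \<rho> * (1 - \<rho>)) \<le> Bd * (2 + Bd * g - \<rho>)"
      unfolding s_def by (simp add: power2_eq_square algebra_simps)
    then have "\<Gamma> * (2 + Bd * \<rho> * (1 - \<rho>)) \<le> Bd * (2 + \<Gamma> - \<rho>)"
      unfolding g_def Bd_sqrt_lo .
    then show ?thesis using 2(3) by (simp add: a_def h_def)
  qed
  define F where "F = \<delta>' / (2 + \<Gamma> - \<rho>)"
  have "(2 * a / (1 - q) + a * Bd * q) * r = a * (2 / (1 - q) + Bd * q) * (F * (1 - \<rho>))"
    by (simp add: r_def F_def distrib_left)
  also have "\<dots> = F * (a * ((2 / (1 - q) + Bd * q) * (1 - \<rho>)))"
    by (simp only: mult_ac)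
  also have "\<dots> \<le> F * (h * Bd * (2 + \<Gamma> - \<rho>))"
    unfolding F_def using order_trans[OF mult_left_mono[OF lhs a_nonneg] key] \<delta>'_pos denominator_pos
    by (intro mult_left_mono) auto
  also have "\<dots> = \<delta> / 2" using denominator_pos by (simp add: F_def half_\<delta> h_def)
  finally show ?thesis .
qed

section \<open>The contraction factor per block and its relation to \<open>\<rho>\<close>\<close>

definition "E = \<Gamma>\<^sup>2 - 1 / \<kappa>\<^sup>2
  * inverse ((\<Sum>i\<in>I - J. (1 + \<alpha> i) / (1 - \<alpha> i))
      - (1 - real (card J)) * (MIN i\<in>I - J. (1 + \<alpha> i) / (1 - \<alpha> i)))
  * ((1 + \<epsilon>) / (1 - \<epsilon>)) ^ card J"

text \<open>Squared contraction factor of the \<open>m - 1\<close> steps following a projection on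
  \<open>C i\<close>: Fejer growth minus the gain from linear regularity.\<close>

definition "\<theta> i = prod \<gamma> (I - {i}) - 1 / (\<kappa>\<^sup>2 * (\<Sum>k\<in>I - {i}. (1 + \<alpha> k) / (1 - \<alpha> k)))"

lemma \<alpha>_less_1: "i \<in> I \<Longrightarrow> i \<notin> J \<Longrightarrow> \<alpha> i < 1"
  using \<alpha>(2)[of i] J(1) by fastforce

lemma exists_other: "\<exists>k. k \<in> I - {i}"
proof (cases "i = 1")
  case True
  then show ?thesis using m by (intro exI[of _ 2]) auto
next
  case False
  then show ?thesis using m by (intro exI[of _ 1]) auto
qed

lemma sum_ge_1:
  assumes "J \<subseteq> {i}"
  shows "(\<Sum>k\<in>I - {i}. (1 + \<alpha> k) / (1 - \<alpha> k)) \<ge> 1"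
proof -
  obtain k where k: "k \<in> I - {i}" using exists_other by blast
  have "\<alpha> k < 1" using \<alpha>_less_1 k assms by blast
  then have "1 \<le> (1 + \<alpha> k) / (1 - \<alpha> k)" using \<alpha>(1)[of k] k by simp
  also have "\<dots> \<le> (\<Sum>k\<in>I - {i}. (1 + \<alpha> k) / (1 - \<alpha> k))"
    using \<alpha> k by (intro member_le_sum) auto
  finally show ?thesis .
qed

text \<open>For empty \<open>J\<close>, omitting \<open>i\<close> removes at least the minimum from
  the sum and at least a factor \<open>lo\<close> from the product. For \<open>J = {i}\<close>
  equality holds, as \<open>\<alpha> i = 1\<close> turns \<open>\<gamma> i\<close> into
  \<open>(1 + \<epsilon>) / (1 - \<epsilon>)\<close>.\<close>

lemma \<theta>_le_E:
  assumes i: "i \<in> I" "J \<subseteq> {i}"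
  shows "\<gamma> i ^ card J * \<theta> i \<le> E"
proof (cases rule: J_cases)
  case 1
  define f where "f k = (1 + \<alpha> k) / (1 - \<alpha> k)" for k
  define S0 where "S0 = sum f (I - {i})"
  have "S0 \<ge> 1" using sum_ge_1[OF i(2)] by (simp add: S0_def f_def)
  have "sum f I = f i + S0" unfolding S0_def using i by (intro sum.remove) auto
  moreover have "Min (f ` I) \<le> f i" using i by simp
  ultimately have S0: "S0 \<le> sum f I - Min (f ` I)" by simp
  have "prod \<gamma> (I - {i}) * lo ^ 1 \<le> prod \<gamma> I"
    using i m by (intro prod_subset_le) auto
  then have "prod \<gamma> (I - {i}) * lo \<le> \<Gamma>\<^sup>2 * lo" using \<Gamma>_sq 1 by simp
  then have "prod \<gamma> (I - {i}) \<le> \<Gamma>\<^sup>2" using lo_gt_1 by (simp add: mult_le_cancel_right)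
  moreover have "1 / \<kappa>\<^sup>2 * inverse (sum f I - Min (f ` I)) \<le> 1 / \<kappa>\<^sup>2 * inverse S0"
    using S0 \<open>S0 \<ge> 1\<close> by (intro mult_left_mono le_imp_inverse_le) auto
  ultimately show ?thesis
    unfolding E_def \<theta>_def using 1 by (simp add: f_def S0_def divide_inverse)
next
  case (2 j)
  then have "j = i" "\<alpha> i = 1" using i J(1) by auto
  have "prod \<gamma> I = \<gamma> i * prod \<gamma> (I - {i})" using i by (intro prod.remove) auto
  then have "\<Gamma>\<^sup>2 = \<gamma> i * prod \<gamma> (I - {i})" using \<Gamma>_sq 2(3) by simp
  moreover have "\<gamma> i = (1 + \<epsilon>) / (1 - \<epsilon>)" using \<gamma>[OF i(1)] \<open>\<alpha> i = 1\<close> by simp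
  ultimately show ?thesis
    unfolding E_def \<theta>_def using 2 \<open>j = i\<close> by (simp add: divide_inverse algebra_simps)
qed

text \<open>For \<open>\<kappa> \<ge> 1\<close> the subtracted term is at most 1, while the product
  has at least one factor, and all its factors exceed 1.\<close>

lemma \<theta>_pos:
  assumes "\<kappa> \<ge> 1" "i \<in> I" "J \<subseteq> {i}"
  shows "\<theta> i > 0"
proof -
  define S0 where "S0 = (\<Sum>k\<in>I - {i}. (1 + \<alpha> k) / (1 - \<alpha> k))"
  have "S0 \<ge> 1" using sum_ge_1[OF assms(3)] by (simp add: S0_def)
  then have "1 \<le> \<kappa>\<^sup>2 * S0" using assms(1) mult_mono[of 1 "\<kappa>\<^sup>2" 1 S0] by simp
  then have "1 / (\<kappa>\<^sup>2 * S0) \<le> 1" by simp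
  obtain k where k: "k \<in> I - {i}" using exists_other by blast
  have "1 < \<gamma> k" using k \<gamma>_gt_1 by simp
  also have "\<dots> \<le> \<gamma> k * prod \<gamma> (I - {i} - {k})"
    using prod_ge_1[of "I - {i} - {k}" \<gamma>] \<gamma>_gt_1 k mult_left_mono[of 1 _ "\<gamma> k"]
    by (auto simp: less_imp_le less_trans[OF zero_less_one])
  also have "\<dots> = prod \<gamma> (I - {i})" using k by (simp add: prod.remove[of _ k])
  finally show ?thesis using \<open>1 / (\<kappa>\<^sup>2 * S0) \<le> 1\<close> by (simp add: \<theta>_def S0_def)
qed

lemma E_pos:
  assumes "\<kappa> \<ge> 1" "i \<in> I" "J \<subseteq> {i}"
  shows "E > 0"
proof -
  have "\<gamma> i ^ card J * \<theta> i > 0" using \<theta>_pos[OF assms] \<gamma>_gt_1[OF assms(2)] by simp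
  then show ?thesis using \<theta>_le_E[OF assms(2,3)] by linarith
qed

text \<open>For positive \<open>E\<close> the truncation at 0 is inactive, so the root in
  \<open>\<rho>\<close> can be undone.\<close>

lemma \<rho>_power:
  assumes "E > 0"
  shows "\<rho> > 0" "(\<rho> ^ M)\<^sup>2 = E"
proof -
  have "real m - 1 + real (card J) = real M" using m by simp
  moreover have "max 0 E = E" using assms by simp
  moreover have "\<rho> = max 0 E powr (1 / (2 * (real m - 1 + real (card J))))"
    unfolding E_def by (rule \<rho>)
  ultimately have \<rho>E: "\<rho> = E powr (1 / (2 * real M))" by (simp only:)
  with assms show "\<rho> > 0" by simp
  have "(\<rho> ^ M)\<^sup>2 = \<rho> ^ (2 * M)" by (rule power_even_eq[symmetric])
  also have "\<dots> = \<rho> powr real (2 * M)"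
    using \<open>\<rho> > 0\<close> by (rule powr_realpow[symmetric])
  also have "\<dots> = E powr (1 / (2 * real M) * real (2 * M))"
    unfolding \<rho>E by (rule powr_powr)
  also have "1 / (2 * real M) * real (2 * M) = 1"
    using M_pos by (metis nonzero_eq_divide_eq of_nat_0_less_iff of_nat_mult of_nat_numeral
        less_irrefl mult_eq_0_iff zero_neq_numeral)
  also have "E powr 1 = E" using assms by simp
  finally show "(\<rho> ^ M)\<^sup>2 = E" .
qed

text \<open>Blocks will start at \<open>Suc s\<close>, just after the reflecting operator if there
  is one. This keeps the index with \<open>\<alpha> = 1\<close>, whose weight \<open>\<beta>\<close>
  is 0, out of the following \<open>m - 1\<close> steps.\<close>

lemma exists_start: "\<exists>s<m. J \<subseteq> {idx s} \<and> (J = {} \<longrightarrow> s = 0)"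
proof (cases rule: J_cases)
  case 1
  then show ?thesis using m by (intro exI[of _ 0]) auto
next
  case (2 j)
  then show ?thesis by (intro exI[of _ "j - 1"]) (auto simp: idx_def)
qed

text \<open>With a reflecting operator the block length is \<open>m\<close>, so the order of
  operators repeats from block to block.\<close>

lemma start_add:
  assumes "J \<subseteq> {idx s}"
  shows "J \<subseteq> {idx (s + k * M)}"
proof (cases rule: J_cases)
  case 2
  then have "M = m" using m by simp
  then show ?thesis using assms by (simp add: idx_def)
qed simp

end

section \<open>Estimates along a cyclic sequence\<close>

locale semi_intrepid_sequence = semi_intrepid_system +
  fixes x :: "nat \<Rightarrow> 'a"
  assumes cyclic: "cyclic_sequence m (\<lambda>i. semi_intrepid_projector (\<alpha> i) (\<tau> i) (C i)) x"
begin

lemma x_Suc: "x (Suc n) \<in> semi_intrepid_projector (\<alpha> (idx n)) (\<tau> (idx n)) (C (idx n)) (x n)"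
  using cyclic by (simp add: cyclic_sequence_def idx_def)

lemma x_Suc_mem: "x n \<in> U \<Longrightarrow> x (Suc n) \<in> C (idx n)"
  using semi_intrepid_projector_mem[OF injectable _ x_Suc] idx \<alpha> \<tau> by metis

lemma quasi_firm_step:
  assumes "x n \<in> U" "y \<in> D" "y \<in> cball w \<delta>"
  shows "(norm (x (Suc n) - y))\<^sup>2 + \<beta> (idx n) * (norm (x n - x (Suc n)))\<^sup>2
    \<le> \<gamma> (idx n) * (norm (x n - y))\<^sup>2"
  unfolding \<gamma>[OF idx]
  using semi_intrepid_projector_quasi_firm[OF regular[OF idx] w[OF idx] assms(1) x_Suc
      \<alpha>[OF idx] \<tau>[OF idx] \<epsilon> subsetD[OF D_subset[OF idx] assms(2)] assms(3)] .

lemma step_le: "norm (x (Suc n) - x n) \<le> 2 * infdist (x n) D"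
proof -
  have "norm (x (Suc n) - x n) \<le> 2 * infdist (x n) (C (idx n))"
    using semi_intrepid_projector_dist[OF x_Suc] idx \<alpha> \<tau> by blast
  also have "\<dots> \<le> 2 * infdist (x n) D"
    using infdist_mono[OF D_subset[OF idx] D_nonempty] by simp
  finally show ?thesis .
qed

abbreviation "growth n l \<equiv> (\<Prod>i<l. \<gamma> (idx (n + i)))"

lemma quasi_firm_chain:
  assumes "\<And>i. i < l \<Longrightarrow> x (n + i) \<in> U" "y \<in> D" "y \<in> cball w \<delta>"
  shows "(norm (x (n + l) - y))\<^sup>2
      + (\<Sum>i<l. \<beta> (idx (n + i)) * (norm (x (n + i) - x (n + Suc i)))\<^sup>2)
    \<le> growth n l * (norm (x n - y))\<^sup>2"
  using assms(1)
proof (induction l)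
  case (Suc l)
  define W where "W = (\<Sum>i<l. \<beta> (idx (n + i)) * (norm (x (n + i) - x (n + Suc i)))\<^sup>2)"
  have g: "\<gamma> (idx (n + l)) \<ge> 1" using \<gamma>_gt_1[OF idx] by (simp add: less_imp_le)
  have W: "W \<ge> 0" unfolding W_def using \<beta>_nonneg[OF idx] by (intro sum_nonneg mult_nonneg_nonneg) auto
  have IH: "(norm (x (n + l) - y))\<^sup>2 + W \<le> growth n l * (norm (x n - y))\<^sup>2"
    using Suc by (simp add: W_def)
  have "(norm (x (n + Suc l) - y))\<^sup>2
      + \<beta> (idx (n + l)) * (norm (x (n + l) - x (n + Suc l)))\<^sup>2 + W
    \<le> \<gamma> (idx (n + l)) * (norm (x (n + l) - y))\<^sup>2 + \<gamma> (idx (n + l)) * W"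
    \<comment> \<open>As \<open>\<gamma>\<close> is at least 1, the earlier step terms
      \<open>W\<close> may be multiplied by it along with the distance.\<close>
    using quasi_firm_step[of "n + l" y] Suc.prems assms mult_right_mono[OF g W] by simp
  also have "\<dots> \<le> \<gamma> (idx (n + l)) * (growth n l * (norm (x n - y))\<^sup>2)"
    using mult_left_mono[OF IH, of "\<gamma> (idx (n + l))"] g by (simp add: algebra_simps)
  finally show ?case by (simp add: W_def algebra_simps)
qed simp

lemma fejer_chain:
  assumes "\<And>i. i < l \<Longrightarrow> x (n + i) \<in> U" "y \<in> D" "y \<in> cball w \<delta>"
  shows "norm (x (n + l) - y) \<le> sqrt (growth n l) * norm (x n - y)"
proof -
  have "0 \<le> (\<Sum>i<l. \<beta> (idx (n + i)) * (norm (x (n + i) - x (n + Suc i)))\<^sup>2)"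
    using \<beta>_nonneg[OF idx] by (intro sum_nonneg mult_nonneg_nonneg) auto
  then have "(norm (x (n + l) - y))\<^sup>2 \<le> growth n l * (norm (x n - y))\<^sup>2"
    using quasi_firm_chain[OF assms] by (smt (verit, best))
  then have "sqrt ((norm (x (n + l) - y))\<^sup>2) \<le> sqrt (growth n l * (norm (x n - y))\<^sup>2)"
    by (rule real_sqrt_le_mono)
  then show ?thesis by (simp add: real_sqrt_mult)
qed

text \<open>Take the farthest set. Either it is \<open>C (idx n)\<close>, which already contains
  \<open>x (Suc n)\<close>, or the block reaches it after some steps, and
  \<open>norm_path_le\<close> bounds the way there by the weighted step lengths.\<close>

lemma max_infdist_le:
  assumes prev: "x n \<in> U" and ball: "\<And>i. i < m - 1 \<Longrightarrow> x (Suc n + i) \<in> U"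
    and \<alpha>1: "\<And>i. i \<in> I - {idx n} \<Longrightarrow> \<alpha> i < 1"
  shows "(MAX i\<in>I. infdist (x (Suc n)) (C i))\<^sup>2 \<le> (\<Sum>i\<in>I - {idx n}. (1 + \<alpha> i) / (1 - \<alpha> i)) *
    (\<Sum>i<m - 1. \<beta> (idx (Suc n + i)) * (norm (x (Suc n + i) - x (Suc n + Suc i)))\<^sup>2)"
    (is "?L \<le> ?S * ?W")
proof -
  have fin: "finite I" "I \<noteq> {}" using m by auto
  have "(MAX i\<in>I. infdist (x (Suc n)) (C i)) \<in> (\<lambda>i. infdist (x (Suc n)) (C i)) ` I"
    using fin by (intro Max_in) auto
  then obtain i where i: "i \<in> I" and eq: "(MAX i\<in>I. infdist (x (Suc n)) (C i)) = infdist (x (Suc n)) (C i)"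
    by auto
  have S0: "?S \<ge> 0" using \<alpha> by (intro sum_nonneg) auto
  have W0: "?W \<ge> 0" using \<beta>_nonneg[OF idx] by (intro sum_nonneg mult_nonneg_nonneg) auto
  show ?thesis
  proof (cases "i = idx n")
    case True
    then have "infdist (x (Suc n)) (C i) = 0" using x_Suc_mem[OF prev] by simp
    then show ?thesis using eq S0 W0 by simp
  next
    case False
    then have "i \<in> (\<lambda>i. idx (Suc n + i)) ` {..<m - 1}"
      using i unfolding idx_image_all_but_last by simp
    then obtain k where k: "k < m - 1" "i = idx (Suc n + k)" by auto
    have mem: "idx (Suc n + j) \<in> I - {idx n}" if "j < m - 1" for j
      using that unfolding idx_image_all_but_last[symmetric] by blast
    have b: "\<beta> (idx (Suc n + j)) > 0" if "j < m - 1" for j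
      using \<alpha>1[OF mem[OF that]] \<alpha>(1)[OF idx[of "Suc n + j"]] by simp
    have "x (Suc n + Suc k) \<in> C i" using x_Suc_mem[OF ball[OF k(1)]] k(2) by simp
    then have "infdist (x (Suc n)) (C i) \<le> norm (x (Suc n) - x (Suc n + Suc k))"
      using infdist_le by (metis dist_norm)
    then have "?L \<le> (norm (x (Suc n) - x (Suc n + Suc k)))\<^sup>2"
      unfolding eq by (intro power_mono infdist_nonneg)
    also have "\<dots> \<le> (\<Sum>j<m - 1. 1 / \<beta> (idx (Suc n + j))) * ?W"
      using norm_path_le[of "m - 1" "\<lambda>j. \<beta> (idx (Suc n + j))" "Suc k" "\<lambda>j. x (Suc n + j)"] b k(1) by simp
    also have "(\<Sum>j<m - 1. 1 / \<beta> (idx (Suc n + j))) = ?S"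
      using sum_idx[of "m - 1" "\<lambda>i. (1 + \<alpha> i) / (1 - \<alpha> i)" "Suc n"] idx_image_all_but_last by simp
    finally show ?thesis .
  qed
qed

text \<open>As \<open>y\<close> is a projection on \<open>D\<close>, linear regularity bounds
  \<open>d\<close> by the maximal distance, hence by the step sum \<open>W\<close>. This bounds
  below the very term that the quasi firm chain adds on the left.\<close>

lemma contract_chain:
  assumes prev: "x n \<in> U" and ball: "\<And>i. i < m - 1 \<Longrightarrow> x (Suc n + i) \<in> U"
    and \<alpha>1: "\<And>i. i \<in> I - {idx n} \<Longrightarrow> \<alpha> i < 1"
    and y: "y \<in> projector D (x (Suc n))"
  shows "(norm (x (n + m) - y))\<^sup>2 \<le> ((\<Prod>i\<in>I - {idx n}. \<gamma> i)
    - 1 / (\<kappa>\<^sup>2 * (\<Sum>i\<in>I - {idx n}. (1 + \<alpha> i) / (1 - \<alpha> i)))) * (norm (x (Suc n) - y))\<^sup>2"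
proof -
  define S where "S = (\<Sum>i\<in>I - {idx n}. (1 + \<alpha> i) / (1 - \<alpha> i))"
  define W where "W = (\<Sum>i<m - 1. \<beta> (idx (Suc n + i)) * (norm (x (Suc n + i) - x (Suc n + Suc i)))\<^sup>2)"
  define d where "d = norm (x (Suc n) - y)"
  have U1: "x (Suc n) \<in> U" using ball[of 0] m by simp
  have d: "d = infdist (x (Suc n)) D" using projectorD[OF y] by (simp add: d_def)
  have "S \<ge> 0" unfolding S_def using \<alpha> by (intro sum_nonneg) auto
  have "d \<le> \<kappa> * (MAX i\<in>I. infdist (x (Suc n)) (C i))"
    using lin_regular U1 by (auto simp: linearly_regular_on_def d D_def)
  then have "d\<^sup>2 \<le> (\<kappa> * (MAX i\<in>I. infdist (x (Suc n)) (C i)))\<^sup>2"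
    by (intro power_mono) (auto simp: d_def)
  also have "\<dots> \<le> \<kappa>\<^sup>2 * (S * W)"
    unfolding power_mult_distrib S_def W_def
    using max_infdist_le[OF prev ball \<alpha>1] by (intro mult_left_mono) auto
  finally have dW: "d\<^sup>2 \<le> (\<kappa>\<^sup>2 * S) * W" by (simp add: algebra_simps)
  have "W \<ge> 0" unfolding W_def using \<beta>_nonneg[OF idx] by (intro sum_nonneg mult_nonneg_nonneg) auto
  have W: "1 / (\<kappa>\<^sup>2 * S) * d\<^sup>2 \<le> W"
  proof (cases "S = 0")
    case False
    then have "\<kappa>\<^sup>2 * S > 0" using \<kappa> \<open>S \<ge> 0\<close> by simp
    then show ?thesis using dW by (simp add: pos_divide_le_eq mult.commute)
  qed (use \<open>W \<ge> 0\<close> in simp)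
  have "norm (y - w) \<le> \<delta>"
    using projector_norm_diff_le[OF y w_D] U1 by (simp add: dist_norm norm_minus_commute)
  then have "(norm (x (Suc n + (m - 1)) - y))\<^sup>2 + W \<le> growth (Suc n) (m - 1) * d\<^sup>2"
    using quasi_firm_chain[OF ball projectorD(1)[OF y]]
    by (simp add: W_def d_def dist_norm norm_minus_commute)
  moreover have "growth (Suc n) (m - 1) = prod \<gamma> (I - {idx n})"
    using prod_idx[of "m - 1" \<gamma> "Suc n"] idx_image_all_but_last by simp
  moreover have "Suc n + (m - 1) = n + m" using m by simp
  ultimately have "(norm (x (n + m) - y))\<^sup>2 + W \<le> prod \<gamma> (I - {idx n}) * d\<^sup>2" by simp
  then show ?thesis
    using W unfolding S_def[symmetric] d_def[symmetric] left_diff_distrib by linarith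
qed

lemma iterates_constant:
  assumes "x 0 \<in> D"
  shows "x n = x 0"
proof (induction n)
  case (Suc n)
  then show ?case
    using semi_intrepid_projector_fixed[OF _ x_Suc[of n]] assms D_subset[OF idx[of n]] by auto
qed simp

lemma block_contract:
  assumes \<kappa>1: "\<kappa> \<ge> 1" and n: "J \<subseteq> {idx n}" and ball: "\<And>i. i < Suc n + M \<Longrightarrow> x i \<in> U"
    and y: "y \<in> projector D (x (Suc n))"
  shows "norm (x (Suc n + M) - y) \<le> \<rho> ^ M * norm (x (Suc n) - y)"
proof -
  define d where "d = norm (x (Suc n) - y)"
  have chain: "(norm (x (n + m) - y))\<^sup>2 \<le> \<theta> (idx n) * d\<^sup>2"
    unfolding \<theta>_def d_def
    by (rule contract_chain) (use ball y \<alpha>_less_1 n in auto)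
  have "(norm (x (Suc n + M) - y))\<^sup>2 \<le> (\<gamma> (idx n) ^ card J * \<theta> (idx n)) * d\<^sup>2"
  proof (cases rule: J_cases)
    case 1
    then have "Suc n + M = n + m" using m by simp
    then show ?thesis using chain 1 by simp
  next
    case 2
    \<comment> \<open>The contraction covers \<open>m - 1\<close> steps; the remaining one is the
      reflecting step \<open>idx (n + m) = idx n\<close>, for which plain Fejer growth is
      used.\<close>
    then have eq: "Suc n + M = Suc (n + m)" using m by simp
    have "x (Suc n) \<in> U" using ball M_pos by simp
    then have "norm (y - w) \<le> \<delta>"
      using projector_norm_diff_le[OF y w_D] by (simp add: dist_norm norm_minus_commute)
    then have yb: "y \<in> cball w \<delta>" by (simp add: dist_norm norm_minus_commute)
    have "x (n + m) \<in> U" using ball[of "n + m"] eq by simp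
    from fejer_chain[of 1 "n + m" y, OF _ projectorD(1)[OF y] yb] this
    have "norm (x (Suc (n + m)) - y) \<le> sqrt (\<gamma> (idx n)) * norm (x (n + m) - y)"
      by (simp add: idx_add_m)
    then have "(norm (x (Suc (n + m)) - y))\<^sup>2 \<le> (sqrt (\<gamma> (idx n)) * norm (x (n + m) - y))\<^sup>2"
      by (intro power_mono) auto
    also have "\<dots> = \<gamma> (idx n) * (norm (x (n + m) - y))\<^sup>2"
      using \<gamma>_gt_1[OF idx[of n]] by (simp add: power_mult_distrib)
    also have "\<dots> \<le> \<gamma> (idx n) * (\<theta> (idx n) * d\<^sup>2)"
      using chain \<gamma>_gt_1[OF idx[of n]] by (intro mult_left_mono) auto
    finally show ?thesis using eq 2 by simp
  qed
  also have "\<dots> \<le> (\<rho> ^ M)\<^sup>2 * d\<^sup>2"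
    using \<theta>_le_E[OF idx n] \<rho>_power(2)[OF E_pos[OF \<kappa>1 idx n]] by (intro mult_right_mono) auto
  finally have "(norm (x (Suc n + M) - y))\<^sup>2 \<le> (\<rho> ^ M * d)\<^sup>2"
    by (simp add: power_mult_distrib)
  then show ?thesis
    unfolding d_def using \<rho>_nonneg by (intro power2_le_imp_le[of "norm _"]) auto
qed

lemma converges_of_ball:
  assumes \<kappa>1: "\<kappa> \<ge> 1" and ball: "\<And>n. x n \<in> U"
  shows "\<exists>xbar\<in>D. converges_R_linearly x xbar \<rho>"
proof -
  obtain s where s: "J \<subseteq> {idx s}" using exists_start by metis
  show ?thesis
  proof (rule converges_R_linearly_of_infdist_blocks[OF D_closed D_nonempty])
    show "\<rho> > 0" using \<rho>_power(1)[OF E_pos[OF \<kappa>1 idx s]] .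
    show "\<rho> < 1" by (rule \<rho>_less_1)
    show "M > 0" by (rule M_pos)
    show "norm (x (Suc n) - x n) \<le> 2 * infdist (x n) D" for n by (rule step_le)
    fix k
    define n where "n = s + k * M"
    have eq: "Suc s + k * M = Suc n" "Suc s + Suc k * M = Suc n + M" by (simp_all add: n_def)
    obtain y where y: "y \<in> projector D (x (Suc n))"
      using projector_nonempty[OF D_closed D_nonempty] by blast
    have "infdist (x (Suc n + M)) D \<le> norm (x (Suc n + M) - y)"
      using infdist_le[OF projectorD(1)[OF y]] by (simp add: dist_norm)
    also have "\<dots> \<le> \<rho> ^ M * norm (x (Suc n) - y)"
      using start_add[OF s, of k] ball y by (intro block_contract[OF \<kappa>1]) (auto simp: n_def)
    finally show "infdist (x (Suc s + Suc k * M)) D \<le> \<rho> ^ M * infdist (x (Suc s + k * M)) D"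
      using projectorD(2)[OF y] unfolding eq by simp
  qed
qed

section \<open>Confinement to the ball and convergence\<close>

lemma within_block:
  assumes "l < M" "\<And>i. i < l \<Longrightarrow> x (n + i) \<in> U" "y \<in> D" "y \<in> cball w \<delta>"
  shows "norm (x (n + l) - y) \<le> Bd * norm (x n - y)"
proof -
  have "l \<le> m" using assms(1) J(2) by linarith
  have "(\<lambda>i. idx (n + i)) ` {..<l} \<subseteq> I" using idx by blast
  moreover have "card ((\<lambda>i. idx (n + i)) ` {..<l}) < M"
    using card_image[OF inj_on_idx[OF \<open>l \<le> m\<close>, of n]] assms(1) by simp
  ultimately have "growth n l \<le> Bd\<^sup>2" unfolding prod_idx[OF \<open>l \<le> m\<close>] by (rule prod_le_Bd_sq)
  then have "sqrt (growth n l) \<le> Bd" using Bd_pos by (intro real_le_lsqrt) auto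
  then have "sqrt (growth n l) * norm (x n - y) \<le> Bd * norm (x n - y)" by (intro mult_right_mono) auto
  with fejer_chain[OF assms(2-4)] show ?thesis by (rule order_trans)
qed

lemma w_cball: "w \<in> cball w \<delta>"
  using \<delta> by simp

text \<open>The blocks here start at multiples of \<open>M\<close>, in general not where contraction
  is shown. Growth by at most \<open>Bd\<close> inside each block suffices.\<close>

lemma ball_of_blocks:
  assumes "\<And>n. x (M * n) \<in> cball w \<delta>'"
  shows "x n \<in> U"
proof -
  have "l < M \<longrightarrow> x (M * k + l) \<in> U" for k l
  proof (induction l rule: less_induct)
    case (less l)
    show ?case
    proof
      assume l: "l < M"
      have "norm (x (M * k + l) - w) \<le> Bd * norm (x (M * k) - w)"
        using less l by (intro within_block w_D w_cball) auto
      also have "\<dots> \<le> Bd * \<delta>'"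
        using assms[of k] Bd_pos by (intro mult_left_mono) (auto simp: dist_norm norm_minus_commute)
      finally show "x (M * k + l) \<in> U"
        using \<delta>'_le(1) by (simp add: dist_norm norm_minus_commute mult.commute)
    qed
  qed
  from this[of "n mod M" "n div M"] show ?thesis using M_pos by simp
qed

lemma ball_of_start:
  assumes \<kappa>1: "\<kappa> \<ge> 1" and x0: "x 0 \<in> cball w r"
  shows "x n \<in> U"
proof -
  obtain s where s: "s < m" "J \<subseteq> {idx s}" "J = {} \<longrightarrow> s = 0" using exists_start by metis
  have "1 \<le> M" using M_pos by linarith
  from power_decreasing[OF this \<rho>_nonneg less_imp_le[OF \<rho>_less_1]]
  have q: "\<rho> ^ M \<le> \<rho>" by simp
  show ?thesis
  proof (rule iterates_stay_in_ball[where D = D and q = "\<rho> ^ M" and a = a and B = Bd and r = r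
        and ?n0.0 = "Suc s" and M = M])
    show "closed D" "w \<in> D" "0 \<le> \<rho> ^ M" "\<rho> ^ M < 1" "0 \<le> a" "1 \<le> Bd" "0 \<le> r" "M > 0"
      using D_closed w_D \<rho>_nonneg q \<rho>_less_1 a_nonneg Bd_ge_1 r_pos M_pos by auto
    show "a * Bd * r \<le> \<delta> / 2" by (rule radius_first_block)
    show "(2 * a / (1 - \<rho> ^ M) + a * Bd * \<rho> ^ M) * r \<le> \<delta> / 2"
      using q \<rho>_nonneg by (intro radius_later_blocks) auto
    \<comment> \<open>Up to the first block start at most one factor occurs if \<open>J\<close> is
      empty. Otherwise \<open>s < m\<close> leaves at most \<open>m\<close> distinct factors,
      bounded by the full product \<open>\<Gamma>\<^sup>2\<close>.\<close>
    show "norm (x l - w) \<le> a * r" if l: "l \<le> Suc s" and ball: "\<And>i. i < l \<Longrightarrow> x i \<in> U" for l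
    proof -
      have "growth 0 l \<le> a\<^sup>2"
      proof (cases rule: J_cases)
        case 1
        have "hi\<^sup>2 \<ge> 1" using hi_ge_1 by simp
        moreover have "\<gamma> (idx 0) \<le> hi\<^sup>2"
          using sqrt_\<gamma>_le_hi[OF idx[of 0]] by (rule sqrt_le_D)
        moreover have "l = 0 \<or> l = 1" using l s(3) 1 by auto
        ultimately show ?thesis using 1(2) by (auto simp: a_def)
      next
        case 2
        have "l \<le> m" using l s(1) by simp
        have "(\<lambda>i. idx (0 + i)) ` {..<l} \<subseteq> I" using idx by blast
        moreover have "card ((\<lambda>i. idx (0 + i)) ` {..<l}) + 0 \<le> m"
          using card_image[OF inj_on_idx[OF \<open>l \<le> m\<close>, of 0]] \<open>l \<le> m\<close> by simp
        ultimately have "growth 0 l * lo ^ 0 \<le> prod \<gamma> I"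
          unfolding prod_idx[OF \<open>l \<le> m\<close>] by (rule prod_subset_le)
        then show ?thesis using \<Gamma>_sq 2(3) by (simp add: a_def)
      qed
      then have g: "sqrt (growth 0 l) \<le> a" using a_nonneg by (intro real_le_lsqrt) auto
      have "norm (x (0 + l) - w) \<le> sqrt (growth 0 l) * norm (x 0 - w)"
        using ball by (intro fejer_chain w_D w_cball) simp
      also have "\<dots> \<le> a * r"
        using g x0 a_nonneg by (intro mult_mono) (auto simp: dist_norm norm_minus_commute)
      finally show ?thesis by simp
    qed
    show "norm (x (Suc s + k * M + l) - y) \<le> Bd * norm (x (Suc s + k * M) - y)"
      if "l < M" "\<And>i. i < l \<Longrightarrow> x (Suc s + k * M + i) \<in> U" "y \<in> D" "y \<in> cball w (2 * (\<delta> / 2))"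
      for k l y
      using that by (intro within_block) auto
    show "norm (x (Suc s + k * M + M) - y) \<le> \<rho> ^ M * norm (x (Suc s + k * M) - y)"
      if "\<And>i. i < Suc s + k * M + M \<Longrightarrow> x i \<in> U" "y \<in> projector D (x (Suc s + k * M))" for k y
      using block_contract[OF \<kappa>1 start_add[OF s(2), of k]] that by simp
  qed
qed

lemma converges:
  assumes "(\<forall>n. x (M * n) \<in> cball w \<delta>') \<or> x 0 \<in> cball w r"
  shows "\<exists>xbar\<in>D. converges_R_linearly x xbar \<rho>"
proof (cases "\<kappa> \<ge> 1")
  case True
  then show ?thesis
    using converges_of_ball ball_of_blocks ball_of_start assms by blast
next
  case False
  \<comment> \<open>Now \<open>\<kappa> < 1\<close>, and only the starting point matters; the first
    alternative locates it through \<open>n = 0\<close>.\<close>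
  have "x 0 \<in> cball w \<delta>'"
    using assms r_le(1) by (elim disjE) (metis mult_0_right, simp)
  then have "x 0 \<in> D"
    using ball_subset_of_linearly_regular False \<delta>'_le(2) by auto
  moreover from this have "converges_R_linearly x (x 0) \<rho>"
    using iterates_constant[OF \<open>x 0 \<in> D\<close>] \<rho>_nonneg \<rho>_less_1
    by (auto simp: converges_R_linearly_def intro!: exI[of _ 0])
  ultimately show ?thesis by blast
qed

end

section \<open>Assembly of the result\<close>

theorem theorem5p19:
  fixes m :: nat
    and C :: "nat \<Rightarrow> 'a::euclidean_space set"
    and w :: 'a
    and \<epsilon> \<delta> \<kappa> \<Gamma> \<rho> \<delta>' :: real
    and \<tau> \<alpha> \<gamma> :: "nat \<Rightarrow> real"
    and I J :: "nat set"
  assumes "I = {1..m}"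
    and "J = {j \<in> I. \<alpha> j = 1}"
    and "\<And>i. i \<in> I \<Longrightarrow> \<gamma> i = (1 + \<alpha> i * \<epsilon>) / (1 - \<epsilon>)"
    and "\<Gamma> = sqrt ((\<Prod>i\<in>I. \<gamma> i) / (MIN i\<in>I. \<gamma> i ^ (1 - card J)))"
    and "\<rho> = (max 0
            (\<Gamma>\<^sup>2 - 1 / \<kappa>\<^sup>2
               * inverse ((\<Sum>i\<in>I - J. (1 + \<alpha> i) / (1 - \<alpha> i))
                   - (1 - real (card J)) * (MIN i\<in>I - J. (1 + \<alpha> i) / (1 - \<alpha> i)))
               * ((1 + \<epsilon>) / (1 - \<epsilon>)) ^ card J))
          powr (1 / (2 * (real m - 1 + real (card J))))"
    and "\<delta>' = \<delta> / (2 * \<Gamma>) * (MIN i\<in>I. sqrt (\<gamma> i))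
               * (MAX i\<in>I. sqrt (\<gamma> i)) powi (int (card J) - 1)"
    and "m \<ge> 2"
    and "\<And>i. i \<in> I \<Longrightarrow> closed (C i)"
    and "w \<in> (\<Inter>i\<in>I. C i)"
    and "0 < \<epsilon>" and "\<epsilon> < 1" and "\<delta> > 0"
    and "\<And>i. i \<in> I \<Longrightarrow> \<tau> i \<ge> 0"
    and "\<And>i. i \<in> I \<Longrightarrow> 0 \<le> \<alpha> i \<and> \<alpha> i \<le> 1"
    and "card J \<le> 1"
    and "\<kappa> > 0" and "linearly_regular_on \<kappa> I C (cball w (\<delta> / 2))"
    and "system_regular_at \<epsilon> \<delta> I C w"
    and "\<And>i. i \<in> I \<Longrightarrow> injectable_on (\<tau> i) (C i) (cball w (\<delta> / 2))"
    and "\<rho> < 1"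
  shows "(\<exists>r>0. \<forall>x. cyclic_sequence m (\<lambda>i. semi_intrepid_projector (\<alpha> i) (\<tau> i) (C i)) x
              \<and> x 0 \<in> cball w r
            \<longrightarrow> (\<exists>xbar \<in> (\<Inter>i\<in>I. C i). converges_R_linearly x xbar \<rho>))
       \<and> (\<forall>x. cyclic_sequence m (\<lambda>i. semi_intrepid_projector (\<alpha> i) (\<tau> i) (C i)) x
              \<and> ((\<forall>n. x ((m - 1 + card J) * n) \<in> cball w \<delta>')
                 \<or> x 0 \<in> cball w (\<delta>' * (1 - \<rho>) / (2 + \<Gamma> - \<rho>)))
            \<longrightarrow> (\<exists>xbar \<in> (\<Inter>i\<in>I. C i). converges_R_linearly x xbar \<rho>))"
proof -
  note I = assms(1)
  have "w \<in> C i" if "i \<in> {1..m}" for i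
    using assms(9) that unfolding I by blast
  moreover have "0 \<le> \<alpha> i" "\<alpha> i \<le> 1" if "i \<in> {1..m}" for i
    using assms(14)[unfolded I, OF that] by simp_all
  moreover have "regular_at \<epsilon> \<delta> (C i) w" if "i \<in> {1..m}" for i
    using assms(18) that unfolding system_regular_at_def I by blast
  ultimately have sys: "semi_intrepid_system m C w \<epsilon> \<delta> \<kappa> \<Gamma> \<rho> \<delta>' \<tau> \<alpha> \<gamma> J"
    by (intro semi_intrepid_system.intro[OF assms(7,2,15,3-6,8)[unfolded I]]
        assms(10-13,16,17,19,20)[unfolded I])
  interpret semi_intrepid_system m C w \<epsilon> \<delta> \<kappa> \<Gamma> \<rho> \<delta>' \<tau> \<alpha> \<gamma> J
    by (rule sys)
  have conv: "\<exists>xbar \<in> (\<Inter>i\<in>I. C i). converges_R_linearly x xbar \<rho>"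
    if "cyclic_sequence m (\<lambda>i. semi_intrepid_projector (\<alpha> i) (\<tau> i) (C i)) x"
      and "(\<forall>n. x ((m - 1 + card J) * n) \<in> cball w \<delta>')
        \<or> x 0 \<in> cball w (\<delta>' * (1 - \<rho>) / (2 + \<Gamma> - \<rho>))" for x
  proof -
    interpret semi_intrepid_sequence m C w \<epsilon> \<delta> \<kappa> \<Gamma> \<rho> \<delta>' \<tau> \<alpha> \<gamma> J x
      by unfold_locales (rule that(1))
    show ?thesis using converges that(2) unfolding r_def D_def I by blast
  qed
  \<comment> \<open>The radius \<open>r\<close> was fixed without reference to a sequence, so the
    first claim follows from the starting-point alternative of the second.\<close>
  show ?thesis
    using conv r_pos unfolding r_def by blast
qed

end
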